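(* Let $z$ be an interior vertex of $\mathcal{T}_h$ with vertex patch $\Omega_z$ and $n_z$ the number of grid vertices in $\Omega_z$ that are directly connected to $z$. Assume $n_z\ge4$ and (1) the sum of each pair of adjacent angles in $\Omega_z$ is no greater than $\pi$; and (2) in addition, when $n_z=4$, the vertices in $\Omega_z$ are not lying on two lines. Then, for every given $\tau_h\in\Sigma_h^1$, there exists a unique minimizer $\tau_z\in[\mathcal{P}_1(\Omega_z)]_s^4$ of $$\tau\mapsto\sum_{e\in\mathcal{E}_h(\Omega_z)}\big([\tau(m_e)]_{nn}-[\tau_h(m_e)]_{nn}\big)^2,\qquad \tau\in[\mathcal{P}_1(\Omega_z)]_s^4,$$ where $m_e$ is the midpoint of the edge $e$.
   Context: $\Omega\subset\mathbb{R}^2$ is a bounded domain with piecewise flat boundary partitioned into relatively open disjoint parts $\Gamma_c,\Gamma_s,\Gamma_f$ (up to closures), and $\mathcal{T}_h$ is a shape-regular triangulation of $\Omega$. $[V]_s^4$ denotes symmetric $2\times2$ matrices with entries in $V$; $\mathcal{P}_1(\Omega_z)$ denotes polynomials of degree at most 1 on $\Omega_z$. On an edge $e$ with unit normal $n_e$, $\tau_{nn}=n_e^\intercal\tau n_e$. $\Sigma_h^1$ is the space of piecewise constant symmetric $2\times2$ matrix fields on $\mathcal{T}_h$ whose normal-normal component is single-valued on each interior edge and vanishes on $\Gamma_s\cup\Gamma_f$. Two vertices are directly connected if they are the endpoints of an edge of $\mathcal{T}_h$. For an interior vertex $z$, the vertex patch $\Omega_z\ni z$ is a closed, connected Lipschitz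 patch which is the union of the triangles of $\mathcal{T}_h$ sharing $z$ as a vertex and possibly a few extra triangles of $\mathcal{T}_h$ surrounding $z$ but not containing $z$. $\mathcal{E}_h(\Omega_z)$ is the set of edges of $\mathcal{T}_h$ in $\Omega_z$. Two angles are adjacent if they share a common vertex and are contained in a pair of triangles sharing an edge. *)

theory Defs
  imports "HOL-Analysis.Analysis"
begin

section \<open>Domain and triangulation\<close>

definition polygonal_domain :: "(real^2) set \<Rightarrow> bool" where
  "polygonal_domain \<Omega> \<longleftrightarrow>
     open \<Omega> \<and> connected \<Omega> \<and> bounded \<Omega> \<and> \<Omega> \<noteq> {} \<and>
     (\<exists>F. finite F \<and> (\<forall>s\<in>F. \<exists>a b. s = closed_segment a b) \<and> frontier \<Omega> = \<Union>F)"

definition boundary_partition ::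
    "(real^2) set \<Rightarrow> (real^2) set \<Rightarrow> (real^2) set \<Rightarrow> (real^2) set \<Rightarrow> bool" where
  "boundary_partition \<Omega> \<Gamma>c \<Gamma>s \<Gamma>f \<longleftrightarrow>
     (\<forall>\<Gamma>\<in>{\<Gamma>c, \<Gamma>s, \<Gamma>f}. openin (top_of_set (frontier \<Omega>)) \<Gamma>) \<and>
     \<Gamma>c \<inter> \<Gamma>s = {} \<and> \<Gamma>c \<inter> \<Gamma>f = {} \<and> \<Gamma>s \<inter> \<Gamma>f = {} \<and>
     closure \<Gamma>c \<union> closure \<Gamma>s \<union> closure \<Gamma>f = frontier \<Omega>"

definition mesh_edges :: "(real^2) set set \<Rightarrow> (real^2) set set" where
  "mesh_edges \<T> = {e. \<exists>T\<in>\<T>. e edge_of T}"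

definition mesh_vertices :: "(real^2) set set \<Rightarrow> (real^2) set" where
  "mesh_vertices \<T> = {v. \<exists>T\<in>\<T>. v extreme_point_of T}"

text \<open>The library predicate \<^const>\<open>triangulation\<close> says that the family is finite, consists of
  simplices, and is conforming (two members meet in a common face).  The last two conjuncts hold
  automatically if \<open>\<Omega> = interior (closure \<Omega>)\<close>; otherwise they say that the cracks of \<open>\<Omega>\<close> are
  resolved by edges.\<close>

definition mesh_of :: "(real^2) set \<Rightarrow> (real^2) set set \<Rightarrow> bool" where
  "mesh_of \<Omega> \<T> \<longleftrightarrow>
     triangulation \<T> \<and> (\<forall>T\<in>\<T>. 2 simplex T) \<and> \<Union>\<T> = closure \<Omega> \<and>
     (\<forall>T\<in>\<T>. interior T \<subseteq> \<Omega>) \<and>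
     (\<forall>e\<in>mesh_edges \<T>. rel_interior e \<subseteq> \<Omega> \<or> e \<subseteq> frontier \<Omega>)"

definition shape_regular :: "real \<Rightarrow> (real^2) set set \<Rightarrow> bool" where
  "shape_regular \<kappa> \<T> \<longleftrightarrow> (\<forall>T\<in>\<T>. \<exists>x \<rho>. \<rho> > 0 \<and> cball x \<rho> \<subseteq> T \<and> diameter T \<le> \<kappa> * \<rho>)"

definition directly_connected :: "(real^2) set set \<Rightarrow> real^2 \<Rightarrow> real^2 \<Rightarrow> bool" where
  "directly_connected \<T> a b \<longleftrightarrow> closed_segment a b \<in> mesh_edges \<T>"

section \<open>Vertex patches\<close>

text \<open>Near each boundary point, the set is the closed epigraph of a Lipschitz function in suitable
  orthonormal coordinates centred at that point.\<close>

definition lipschitz_boundary :: "(real^2) set \<Rightarrow> bool" where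
  "lipschitz_boundary S \<longleftrightarrow>
     (\<forall>x\<in>frontier S. \<exists>r L. \<exists>f :: real^2 \<Rightarrow> real^2. \<exists>\<phi> :: real \<Rightarrow> real.
        r > 0 \<and> orthogonal_transformation f \<and> L-lipschitz_on UNIV \<phi> \<and>
        (\<forall>p\<in>ball x r. p \<in> S \<longleftrightarrow> \<phi> (f (p - x) $ 1) \<le> f (p - x) $ 2))"

definition vertex_patch :: "(real^2) set set \<Rightarrow> real^2 \<Rightarrow> (real^2) set \<Rightarrow> bool" where
  "vertex_patch \<T> z W \<longleftrightarrow>
     (\<exists>P. {T\<in>\<T>. z extreme_point_of T} \<subseteq> P \<and> P \<subseteq> \<T> \<and> W = \<Union>P) \<and>
     closed W \<and> connected W \<and> lipschitz_boundary W"

definition patch_triangles :: "(real^2) set set \<Rightarrow> (real^2) set \<Rightarrow> (real^2) set set" where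
  "patch_triangles \<T> W = {T\<in>\<T>. T \<subseteq> W}"

definition patch_edges :: "(real^2) set set \<Rightarrow> (real^2) set \<Rightarrow> (real^2) set set" where
  "patch_edges \<T> W = {e\<in>mesh_edges \<T>. e \<subseteq> W}"

definition patch_vertices :: "(real^2) set set \<Rightarrow> (real^2) set \<Rightarrow> (real^2) set" where
  "patch_vertices \<T> W = mesh_vertices \<T> \<inter> W"

definition num_neighbours :: "(real^2) set set \<Rightarrow> real^2 \<Rightarrow> (real^2) set \<Rightarrow> nat" where
  "num_neighbours \<T> z W = card {v\<in>patch_vertices \<T> W. directly_connected \<T> z v}"

text \<open>The angle at \<open>v\<close> of the triangle with vertices \<open>v\<close>, \<open>a\<close>, \<open>b\<close>.\<close>

definition angle_at :: "real^2 \<Rightarrow> real^2 \<Rightarrow> real^2 \<Rightarrow> real" where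
  "angle_at v a b = arccos ((a - v) \<bullet> (b - v) / (norm (a - v) * norm (b - v)))"

text \<open>Two triangles of a conforming mesh with adjacent angles at \<open>v\<close> share an edge from \<open>v\<close> to some
  \<open>b\<close>, hence are \<open>vab\<close> and \<open>vbc\<close>.\<close>

definition adjacent_angle_condition :: "(real^2) set set \<Rightarrow> (real^2) set \<Rightarrow> bool" where
  "adjacent_angle_condition \<T> W \<longleftrightarrow>
     (\<forall>v a b c. convex hull {v, a, b} \<in> patch_triangles \<T> W \<longrightarrow>
        convex hull {v, b, c} \<in> patch_triangles \<T> W \<longrightarrow>
        convex hull {v, a, b} \<noteq> convex hull {v, b, c} \<longrightarrow>
        angle_at v a b + angle_at v b c \<le> pi)"

definition is_line :: "(real^2) set \<Rightarrow> bool" where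
  "is_line L \<longleftrightarrow> affine L \<and> aff_dim L = 1"

definition on_two_lines :: "(real^2) set \<Rightarrow> bool" where
  "on_two_lines V \<longleftrightarrow> (\<exists>L1 L2. is_line L1 \<and> is_line L2 \<and> V \<subseteq> L1 \<union> L2)"

section \<open>Matrix fields\<close>

text \<open>The normal is determined up to sign, which does not affect normal-normal components.\<close>

definition edge_normal :: "(real^2) set \<Rightarrow> real^2" where
  "edge_normal e = (SOME n. norm n = 1 \<and> (\<forall>x\<in>e. \<forall>y\<in>e. n \<bullet> (x - y) = 0))"

definition edge_midpoint :: "(real^2) set \<Rightarrow> real^2" where
  "edge_midpoint e = (THE m. \<exists>a b. e = closed_segment a b \<and> m = midpoint a b)"

definition nn :: "(real^2) set \<Rightarrow> real^2^2 \<Rightarrow> real" where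
  "nn e A = edge_normal e \<bullet> (A *v edge_normal e)"

text \<open>Functions on \<open>S\<close> are represented by functions on the plane that vanish off \<open>S\<close>.\<close>

definition P1 :: "(real^2) set \<Rightarrow> (real^2 \<Rightarrow> real) set" where
  "P1 S = {p. \<exists>a b. \<forall>x. p x = (if x \<in> S then a + b \<bullet> x else 0)}"

definition sym_fields :: "(real^2 \<Rightarrow> real) set \<Rightarrow> (real^2 \<Rightarrow> real^2^2) set" where
  "sym_fields V = {\<tau>. (\<forall>x. transpose (\<tau> x) = \<tau> x) \<and> (\<forall>i j. (\<lambda>x. \<tau> x $ i $ j) \<in> V)}"

text \<open>A piecewise constant field is given by its value \<open>\<tau>h T\<close> on each triangle \<open>T\<close>, so that
  \<open>nn e (\<tau>h T)\<close> is the normal-normal component of its trace from \<open>T\<close> on an edge \<open>e\<close> of \<open>T\<close>.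
  The argument \<open>\<Gamma>0\<close> is the boundary part on which this component vanishes; end points of edges
  are disregarded, as there is no normal at a vertex.\<close>

definition Sigma1 ::
    "(real^2) set \<Rightarrow> (real^2) set \<Rightarrow> (real^2) set set \<Rightarrow> ((real^2) set \<Rightarrow> real^2^2) set" where
  "Sigma1 \<Omega> \<Gamma>0 \<T> = {\<tau>h.
     (\<forall>T\<in>\<T>. transpose (\<tau>h T) = \<tau>h T) \<and>
     (\<forall>e T T'. T \<in> \<T> \<longrightarrow> T' \<in> \<T> \<longrightarrow> e edge_of T \<longrightarrow> e edge_of T' \<longrightarrow> rel_interior e \<subseteq> \<Omega> \<longrightarrow>
        nn e (\<tau>h T) = nn e (\<tau>h T')) \<and>
     (\<forall>e T. T \<in> \<T> \<longrightarrow> e edge_of T \<longrightarrow> rel_interior e \<inter> \<Gamma>0 \<noteq> {} \<longrightarrow> nn e (\<tau>h T) = 0)}"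

text \<open>The value of \<open>[\<tau>h]\<close> in the normal-normal direction at the midpoint (equivalently, any relative
  interior point) of \<open>e\<close>.  For members of \<^const>\<open>Sigma1\<close> the chosen triangle matters only if \<open>e\<close> is
  part of a crack of the domain, where one of the two traces is taken.\<close>

definition edge_nn_value :: "(real^2) set set \<Rightarrow> ((real^2) set \<Rightarrow> real^2^2) \<Rightarrow> (real^2) set \<Rightarrow> real" where
  "edge_nn_value \<T> \<tau>h e = nn e (\<tau>h (SOME T. T \<in> \<T> \<and> e edge_of T))"

definition recovery_functional ::
    "(real^2) set set \<Rightarrow> (real^2) set \<Rightarrow> ((real^2) set \<Rightarrow> real^2^2) \<Rightarrow> (real^2 \<Rightarrow> real^2^2) \<Rightarrow> real" where
  "recovery_functional \<T> W \<tau>h \<tau> =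
     (\<Sum>e\<in>patch_edges \<T> W. (nn e (\<tau> (edge_midpoint e)) - edge_nn_value \<T> \<tau>h e)\<^sup>2)"

end

theory Submission
  imports Defs
begin

text \<open>
  The nine coefficients of a symmetric matrix field \<open>\<tau>\<close> of degree one are determined by a linear
  least squares problem, so a unique minimizer exists as soon as \<open>\<tau> = 0\<close> is the only field with
  vanishing normal-normal component at all edge midpoints (\<open>least_squares_split\<close>,
  \<open>nn_vanishing_imp_zero\<close>).

  Let \<open>\<tau>\<close> be such a field.  Rotating \<open>\<tau>\<close> by a right angle exchanges normal and tangential
  components.  The second derivatives of the rotated field vanish, so it satisfies the
  compatibility condition of linear elasticity and is the strain of a quadratic displacement \<open>u\<close>,
  which is unique up to rigid motions.  Integrating the strain along an edge \<open>ab\<close> gives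
  \<open>(u b - u a) \<bullet> (b - a)\<close> on the one hand and, by the midpoint rule, a multiple of the normal-normal
  component of \<open>\<tau>\<close> at the midpoint on the other (\<open>displacement_stretch\<close>).  Hence the values of \<open>u\<close> at
  the vertices form an infinitesimal flex of the framework of edges of the patch.

  Triangles are rigid.  After subtraction of a rigid motion, \<open>u\<close> vanishes at the vertices of one
  triangle, and then at those of every triangle that can be reached through common edges.  These are
  all triangles of the patch: otherwise the patch would be the union of two closed sets that meet in
  finitely many vertices, and a closed connected set with Lipschitz boundary has no such cut
  (\<open>lipschitz_no_finite_cut\<close>, \<open>patch_vertex_propagation\<close>).

  It remains to see that a quadratic polynomial that vanishes at all vertices of the patch is zero
  (\<open>conic_through_patch_vertices\<close>).  Write it as \<open>v \<mapsto> A(v, v) + l \<bullet> v\<close> with \<open>v\<close> measured from \<open>z\<close>.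
  The angle condition at \<open>z\<close> and at its neighbours says that the polygon of neighbours is convex and
  that no two consecutive triangles at \<open>z\<close> span more than a half plane.  Two identities for the
  chords of a conic show that this is incompatible with \<open>l \<noteq> 0\<close>, unless the conic contains its
  tangent at \<open>z\<close>, which the angles at \<open>z\<close> alone exclude (\<open>conic_through_fan_has_no_linear_part\<close>).
  If \<open>l = 0\<close> and \<open>A \<noteq> 0\<close>, then all vertices lie on two lines through \<open>z\<close>.  As a ray from \<open>z\<close> contains at
  most one neighbour, there are four neighbours, which is the case that hypothesis (2) rules out.
\<close>

section \<open>Plane vectors\<close>

text \<open>Twice the signed area of the triangle \<open>0uv\<close>, which is positive if \<open>v\<close> is counterclockwise from \<open>u\<close>.\<close>

definition cross2 :: "real^2 \<Rightarrow> real^2 \<Rightarrow> real" where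
  "cross2 u v = u$1 * v$2 - u$2 * v$1"

definition rot :: "real^2 \<Rightarrow> real^2" where
  "rot v = vector [- v$2, v$1]"

text \<open>The symmetric bilinear form with matrix entries \<open>p\<close>, \<open>r\<close>, \<open>r\<close>, \<open>s\<close>.\<close>

definition bil :: "real \<Rightarrow> real \<Rightarrow> real \<Rightarrow> real^2 \<Rightarrow> real^2 \<Rightarrow> real" where
  "bil p r s u v = p * (u$1 * v$1) + r * (u$1 * v$2 + u$2 * v$1) + s * (u$2 * v$2)"

lemma inner2: "(u::real^2) \<bullet> v = u$1 * v$1 + u$2 * v$2"
  by (simp add: inner_vec_def sum_2)

lemma rot_nth [simp]: "rot v $ 1 = - v$2" "rot v $ 2 = v$1"
  by (simp_all add: rot_def)

lemma vec2_eq_iff: "(u::real^2) = v \<longleftrightarrow> u$1 = v$1 \<and> u$2 = v$2"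
  by (simp add: vec_eq_iff forall_2)

lemma cross2_self [simp]: "cross2 v v = 0"
  by (simp add: cross2_def)

lemma cross2_skew: "cross2 v u = - cross2 u v"
  by (simp add: cross2_def algebra_simps)

lemma parallel_pos_multiple:
  assumes "cross2 u v = 0" "m \<bullet> u > 0" "m \<bullet> v > 0"
  shows "v = ((m \<bullet> v) / (m \<bullet> u)) *\<^sub>R u"
proof -
  have "(m \<bullet> u) *\<^sub>R v - (m \<bullet> v) *\<^sub>R u = cross2 u v *\<^sub>R rot m"
    unfolding vec2_eq_iff by (simp add: cross2_def inner2 algebra_simps)
  then have "(m \<bullet> u) *\<^sub>R v = (m \<bullet> v) *\<^sub>R u" using assms(1) by simp
  then have "(1 / (m \<bullet> u)) *\<^sub>R ((m \<bullet> u) *\<^sub>R v) = (1 / (m \<bullet> u)) *\<^sub>R ((m \<bullet> v) *\<^sub>R u)" by simp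
  then show ?thesis using assms(2) by simp
qed

lemma orthogonal_to_independent:
  assumes "m \<bullet> x = 0" "m \<bullet> y = 0" "cross2 x y \<noteq> 0"
  shows "m = 0"
proof -
  have "cross2 x y *\<^sub>R m = (m \<bullet> y) *\<^sub>R rot x - (m \<bullet> x) *\<^sub>R rot y"
    unfolding vec2_eq_iff by (simp add: cross2_def inner2 algebra_simps)
  then show ?thesis using assms by simp
qed

section \<open>Conics through the ends of a convex fan\<close>

text \<open>Let \<open>0\<close>, \<open>a\<close>, \<open>b\<close>, \<open>c\<close> lie on the conic \<open>A(v, v) + l \<bullet> v = 0\<close>.  The first factor on the right is
  twice the signed area of the triangle \<open>abc\<close>, so it tells whether the polygon \<open>0abc\<close> is convex at
  \<open>b\<close>, and the second whether the angle from \<open>a\<close> to \<open>c\<close> is at most \<open>\<pi>\<close>.  If both are nonnegative, the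
  sign of \<open>A\<close> on the chord \<open>a - c\<close> is opposite to that of \<open>l \<bullet> b\<close>.  The identity follows by
  inserting \<open>cross2 a c *\<^sub>R b = cross2 b c *\<^sub>R a + cross2 a b *\<^sub>R c\<close> into the equation of the conic.\<close>

lemma conic_corner_identity:
  assumes "bil p r s a a = - (l \<bullet> a)" "bil p r s b b = - (l \<bullet> b)" "bil p r s c c = - (l \<bullet> c)"
  shows "cross2 a b * cross2 b c * bil p r s (a - c) (a - c)
     = - ((cross2 a b + cross2 b c - cross2 a c) * cross2 a c * (l \<bullet> b))"
proof -
  define \<alpha> \<beta> D where "\<alpha> = cross2 b c" and "\<beta> = cross2 a b" and "D = cross2 a c"
  have 1: "D * (l \<bullet> b) = \<alpha> * (l \<bullet> a) + \<beta> * (l \<bullet> c)"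
    by (simp add: \<alpha>_def \<beta>_def D_def cross2_def inner2 algebra_simps)
  have 2: "D^2 * bil p r s b b = \<alpha>^2 * bil p r s a a + 2 * \<alpha> * \<beta> * bil p r s a c + \<beta>^2 * bil p r s c c"
    by (simp add: \<alpha>_def \<beta>_def D_def cross2_def bil_def algebra_simps power2_eq_square)
  have 3: "bil p r s (a - c) (a - c) = bil p r s a a - 2 * bil p r s a c + bil p r s c c"
    by (simp add: bil_def algebra_simps)
  have "\<beta> * \<alpha> * bil p r s (a - c) (a - c) = - ((\<beta> + \<alpha> - D) * D * (l \<bullet> b))"
    using 1 2 unfolding 3 assms by algebra
  then show ?thesis by (simp add: \<alpha>_def \<beta>_def D_def)
qed

text \<open>The vector \<open>(l \<bullet> f) *\<^sub>R e - (l \<bullet> e) *\<^sub>R f\<close> is tangent to the conic at \<open>0\<close>, hence a multiple of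
  \<open>rot l\<close>, the factor being \<open>cross2 f e\<close>.  So the sign of \<open>A\<close> on a chord can be read off from its sign
  on the tangent at \<open>0\<close> and from the sides of this tangent on which the end points lie.\<close>

lemma conic_chord_identity:
  assumes "bil p r s f f = - (l \<bullet> f)" "bil p r s e e = - (l \<bullet> e)"
  shows "(l \<bullet> f) * (l \<bullet> e) * bil p r s (f - e) (f - e) = (cross2 f e)^2 * bil p r s (rot l) (rot l)"
proof -
  define x y where "x = l \<bullet> f" and "y = l \<bullet> e"
  have 1: "(cross2 f e)^2 * bil p r s (rot l) (rot l)
      = x^2 * bil p r s e e - 2 * x * y * bil p r s f e + y^2 * bil p r s f f"
    by (simp add: x_def y_def cross2_def inner2 bil_def algebra_simps power2_eq_square)
  have 2: "bil p r s (f - e) (f - e) = bil p r s f f - 2 * bil p r s f e + bil p r s e e"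
    by (simp add: bil_def algebra_simps)
  have "x * y * bil p r s (f - e) (f - e)
      = x^2 * bil p r s e e - 2 * x * y * bil p r s f e + y^2 * bil p r s f f"
    unfolding 2 assms x_def [symmetric] y_def [symmetric] by algebra
  then show ?thesis unfolding 1 x_def y_def .
qed

text \<open>The geometry around an interior vertex at the origin, with neighbours \<open>N\<close>: \<open>R b c\<close> says that
  \<open>0bc\<close> is a triangle of the fan with \<open>c\<close> next after \<open>b\<close> counterclockwise.  The bounds on \<open>cross2 a c\<close>
  are the condition on adjacent angles, at the centre and at \<open>b\<close> respectively.\<close>

definition convex_fan :: "(real^2) set \<Rightarrow> (real^2 \<Rightarrow> real^2 \<Rightarrow> bool) \<Rightarrow> bool" where
  "convex_fan N R \<longleftrightarrow> finite N \<and> N \<noteq> {} \<and>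
     (\<forall>b\<in>N. \<exists>c\<in>N. R b c) \<and> (\<forall>b c. R b c \<longrightarrow> cross2 b c > 0) \<and>
     (\<forall>a b c. R a b \<longrightarrow> R b c \<longrightarrow> 0 \<le> cross2 a c \<and> cross2 a c \<le> cross2 a b + cross2 b c)"

text \<open>Take for \<open>b\<close> the last neighbour, counterclockwise, in the open half plane.  Its successor \<open>c\<close> is
  outside, and so is the next one \<open>d\<close>, since going from \<open>b\<close> to \<open>d\<close> turns by an angle of at most
  \<open>\<pi>\<close>.\<close>

lemma fan_leaves_half_plane:
  assumes fan: "convex_fan N R" and b0: "b0 \<in> N" "m \<bullet> b0 > 0"
  obtains b c d where "b \<in> N" "c \<in> N" "d \<in> N" "R b c" "R c d" "m \<bullet> b > 0" "m \<bullet> c \<le> 0" "m \<bullet> d \<le> 0"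
proof -
  define H where "H = {x\<in>N. m \<bullet> x > 0}"
  \<comment> \<open>Slopes increase counterclockwise in the half plane.\<close>
  define t where "t x = cross2 m x / (m \<bullet> x)" for x
  have "finite H" "H \<noteq> {}" using fan b0 by (auto simp: H_def convex_fan_def)
  then obtain b where b: "b \<in> H" and mx: "\<And>x. x \<in> H \<Longrightarrow> t x \<le> t b"
    using Max_in[of "t ` H"] Max_ge[of "t ` H"] by (metis (no_types, lifting) empty_is_image finite_imageI image_iff imageI)
  have mb: "m \<bullet> b > 0" "b \<in> N" using b by (auto simp: H_def)
  have m0: "m \<bullet> m > 0" using mb by auto
  have last: "cross2 b x \<le> 0" if "x \<in> H" for x
  proof -
    have mxp: "m \<bullet> x > 0" using that by (auto simp: H_def)
    have "cross2 b x * (m \<bullet> m) = (m \<bullet> b) * cross2 m x - cross2 m b * (m \<bullet> x)"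
      by (simp add: cross2_def inner2 algebra_simps)
    also have "\<dots> = (m \<bullet> b) * (m \<bullet> x) * (t x - t b)"
      using mb mxp by (simp add: t_def field_simps)
    also have "\<dots> \<le> 0" using mx[OF that] mb mxp by (simp add: mult_nonneg_nonpos)
    finally show ?thesis using m0 by (simp add: mult_le_0_iff)
  qed
  obtain c where c: "c \<in> N" "R b c" using fan mb(2) unfolding convex_fan_def by blast
  obtain d where d: "d \<in> N" "R c d" using fan c(1) unfolding convex_fan_def by blast
  have bc: "cross2 b c > 0" and cd: "cross2 c d > 0" and bd: "cross2 b d \<ge> 0"
    using fan c d by (auto simp: convex_fan_def)
  have mc: "m \<bullet> c \<le> 0" using last[of c] bc c(1) by (metis (mono_tags, lifting) H_def mem_Collect_eq not_le)
  have md: "m \<bullet> d \<le> 0"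
  proof (rule ccontr)
    assume "\<not> m \<bullet> d \<le> 0"
    then have md: "m \<bullet> d > 0" by simp
    then have "d \<in> H" using d by (simp add: H_def)
    then have 0: "cross2 b d = 0" using last bd by force
    define k where "k = (m \<bullet> d) / (m \<bullet> b)"
    have k: "k > 0" "d = k *\<^sub>R b"
      using parallel_pos_multiple[OF 0 mb(1) md] mb md by (auto simp: k_def)
    have "cross2 c d = - k * cross2 b c" unfolding k(2) by (simp add: cross2_def algebra_simps)
    then show False using mult_pos_pos[OF k(1) bc] cd by linarith
  qed
  show ?thesis using that[OF mb(2) c(1) d(1) c(2) d(2) mb(1) mc md] .
qed

text \<open>If no neighbour were in the open half plane, two consecutive ones would lie on its boundary line, by
  the preceding lemma for \<open>- m\<close>.\<close>

lemma fan_crosses_half_plane: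
  assumes fan: "convex_fan N R" and "m \<noteq> 0"
  obtains b c d where "b \<in> N" "c \<in> N" "d \<in> N" "R b c" "R c d" "m \<bullet> b > 0" "m \<bullet> c \<le> 0" "m \<bullet> d \<le> 0"
proof (cases "\<exists>x\<in>N. m \<bullet> x > 0")
  case True
  then show ?thesis using fan_leaves_half_plane[OF fan] that by metis
next
  case False
  obtain x y where xy: "x \<in> N" "y \<in> N" "R x y" using fan by (fastforce simp: convex_fan_def)
  then have "cross2 x y > 0" using fan by (auto simp: convex_fan_def)
  then have "m \<bullet> x < 0 \<or> m \<bullet> y < 0" using orthogonal_to_independent[of m x y] False xy \<open>m \<noteq> 0\<close> by force
  then obtain w where w: "w \<in> N" "(- m) \<bullet> w > 0" using xy by auto
  obtain b c d where "b \<in> N" "c \<in> N" "d \<in> N" "R b c" "R c d" "(- m) \<bullet> b > 0" "(- m) \<bullet> c \<le> 0" "(- m) \<bullet> d \<le> 0"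
    using fan_leaves_half_plane[OF fan w] by metis
  then have "m \<bullet> c = 0" "m \<bullet> d = 0" "cross2 c d > 0" using False fan
    by (auto simp: convex_fan_def not_less order.antisym)
  then show ?thesis using orthogonal_to_independent \<open>m \<noteq> 0\<close> by force
qed

text \<open>Apply \<open>fan_crosses_half_plane\<close> to the half plane bounded by the tangent \<open>l \<bullet> v = 0\<close>.  It gives three
  consecutive neighbours \<open>f\<close>, \<open>c\<close>, \<open>e\<close> such that the tangent separates \<open>f\<close> from \<open>c\<close> and \<open>e\<close>.  As \<open>A\<close> is
  positive on the tangent, the chord identity makes \<open>A\<close> negative on \<open>f - e\<close>, whereas the corner identity
  at \<open>c\<close> makes it nonnegative.\<close>

lemma conic_through_fan_pos:
  assumes fan: "convex_fan N R" and q: "\<And>v. v \<in> N \<Longrightarrow> bil p r s v v = - (l \<bullet> v)"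
    and pos: "bil p r s (rot l) (rot l) > 0"
  shows False
proof -
  have l0: "l \<noteq> 0" using pos by (auto simp: bil_def)
  have nz: "l \<bullet> v \<noteq> 0" if "v \<in> N" "v \<noteq> 0" for v
  proof
    assume 0: "l \<bullet> v = 0"
    have 1: "(l \<bullet> l) *\<^sub>R v = (rot l \<bullet> v) *\<^sub>R rot l + (l \<bullet> v) *\<^sub>R l"
      unfolding vec2_eq_iff by (simp add: inner2 algebra_simps)
    have "(l \<bullet> l)^2 * bil p r s v v = bil p r s ((l \<bullet> l) *\<^sub>R v) ((l \<bullet> l) *\<^sub>R v)"
      by (simp add: bil_def power2_eq_square algebra_simps)
    also have "\<dots> = (rot l \<bullet> v)^2 * bil p r s (rot l) (rot l)"
      unfolding 1 0 by (simp add: bil_def power2_eq_square algebra_simps)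
    finally have "rot l \<bullet> v = 0" using q[OF that(1)] 0 pos by simp
    then show False using 1 0 l0 that(2) by simp
  qed
  obtain f c e where H: "f \<in> N" "c \<in> N" "e \<in> N" "R f c" "R c e" "l \<bullet> f > 0" "l \<bullet> c \<le> 0" "l \<bullet> e \<le> 0"
    using fan_crosses_half_plane[OF fan l0] by metis
  have X: "cross2 f c > 0" "cross2 c e > 0" "cross2 f e \<ge> 0" "cross2 f e \<le> cross2 f c + cross2 c e"
    using fan H by (auto simp: convex_fan_def)
  then have "c \<noteq> 0" "e \<noteq> 0" by (auto simp: cross2_def)
  then have L: "l \<bullet> c < 0" "l \<bullet> e < 0" using nz H by force+
  have fe: "cross2 f e \<noteq> 0"
  proof
    assume 0: "cross2 f e = 0"
    have "(l \<bullet> f) *\<^sub>R e - (l \<bullet> e) *\<^sub>R f = cross2 f e *\<^sub>R rot l"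
      unfolding vec2_eq_iff by (simp add: cross2_def inner2 algebra_simps)
    then have E: "(l \<bullet> f) *\<^sub>R e = (l \<bullet> e) *\<^sub>R f" using 0 by simp
    have "(l \<bullet> f)^2 * bil p r s e e = bil p r s ((l \<bullet> f) *\<^sub>R e) ((l \<bullet> f) *\<^sub>R e)"
      by (simp add: bil_def power2_eq_square algebra_simps)
    also have "\<dots> = (l \<bullet> e)^2 * bil p r s f f"
      unfolding E by (simp add: bil_def power2_eq_square algebra_simps)
    finally have "(l \<bullet> f)^2 * (- (l \<bullet> e)) = (l \<bullet> e)^2 * (- (l \<bullet> f))" using q H by simp
    moreover have "(l \<bullet> f)^2 * (- (l \<bullet> e)) > 0" "(l \<bullet> e)^2 * (l \<bullet> f) > 0"
      using H L by (auto intro!: mult_pos_pos mult_pos_neg)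
    ultimately show False by simp
  qed
  have "(l \<bullet> f) * (l \<bullet> e) * bil p r s (f - e) (f - e) > 0"
    using conic_chord_identity[OF q[OF H(1)] q[OF H(3)]] fe pos by simp
  moreover have "(l \<bullet> f) * (l \<bullet> e) < 0" using H L by (simp add: mult_pos_neg)
  ultimately have neg: "bil p r s (f - e) (f - e) < 0"
    by (meson linorder_not_less mult_nonpos_nonneg order_less_imp_le)
  then have "cross2 f c * cross2 c e * bil p r s (f - e) (f - e) < 0"
    using X by (simp add: mult_pos_neg)
  moreover have "(cross2 f c + cross2 c e - cross2 f e) * cross2 f e * (l \<bullet> c) \<le> 0"
    using X L by (intro mult_nonneg_nonpos mult_nonneg_nonneg) auto
  ultimately show False using conic_corner_identity[OF q[OF H(1)] q[OF H(2)] q[OF H(3)]] by simp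
qed

text \<open>A change of sign of the polynomial covers the case that \<open>A\<close> is negative on the tangent.  If \<open>A\<close>
  vanishes on the tangent, then the conic consists of the tangent and at most one other line, on which a
  linear form \<open>m\<close> is constant and negative.  But by \<open>fan_crosses_half_plane\<close> for \<open>- m\<close>, two consecutive
  neighbours satisfy \<open>m \<bullet> v \<ge> 0\<close>, so they both lie on the tangent, which is absurd.\<close>

lemma conic_through_fan_has_no_linear_part:
  assumes fan: "convex_fan N R" and q: "\<And>v. v \<in> N \<Longrightarrow> bil p r s v v + l \<bullet> v = 0"
  shows "l = 0"
proof (rule ccontr)
  assume l0: "l \<noteq> 0"
  consider "bil p r s (rot l) (rot l) > 0" | "bil p r s (rot l) (rot l) < 0" | "bil p r s (rot l) (rot l) = 0"
    by linarith
  then show False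
  proof cases
    case 1
    then show ?thesis using conic_through_fan_pos[OF fan, of p r s l] q by force
  next
    case 2
    have "bil (-p) (-r) (-s) (rot (-l)) (rot (-l)) > 0"
      using 2 by (simp add: bil_def)
    moreover have "bil (-p) (-r) (-s) v v = - ((-l) \<bullet> v)" if "v \<in> N" for v
      using q[OF that] by (simp add: bil_def)
    ultimately show ?thesis using conic_through_fan_pos[OF fan] by blast
  next
    case 3
    define m where "m = bil p r s l l *\<^sub>R l + (2 * bil p r s l (rot l)) *\<^sub>R rot l"
    define k where "k = (l \<bullet> l)^2"
    have k: "k > 0" using l0 by (simp add: k_def)
    have fac: "k * bil p r s v v = (l \<bullet> v) * (m \<bullet> v)" for v
    proof -
      have "k * bil p r s v v = (l \<bullet> v) * (m \<bullet> v) + (rot l \<bullet> v)^2 * bil p r s (rot l) (rot l)"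
        by (simp add: k_def m_def bil_def inner2 power2_eq_square algebra_simps)
      then show ?thesis using 3 by simp
    qed
    have alt: "l \<bullet> v = 0 \<or> m \<bullet> v = - k" if "v \<in> N" for v
    proof -
      have "k * (bil p r s v v + l \<bullet> v) = (l \<bullet> v) * (m \<bullet> v + k)"
        using fac[of v] by (simp add: algebra_simps)
      then show ?thesis using q[OF that] by (auto simp: add_eq_0_iff2)
    qed
    show False
    proof (cases "m = 0")
      case True
      obtain x y where xy: "x \<in> N" "y \<in> N" "R x y" using fan by (fastforce simp: convex_fan_def)
      moreover then have "cross2 x y > 0" using fan by (auto simp: convex_fan_def)
      ultimately show ?thesis
        using orthogonal_to_independent[of l x y] l0 alt[of x] alt[of y] True k by auto
    next
      case False
      then obtain b c d where H: "c \<in> N" "d \<in> N" "R c d" "(- m) \<bullet> c \<le> 0" "(- m) \<bullet> d \<le> 0"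
        using fan_crosses_half_plane[OF fan, of "- m"] by (metis neg_equal_0_iff_equal)
      then have "l \<bullet> c = 0" "l \<bullet> d = 0" using alt[of c] alt[of d] k by auto
      moreover have "cross2 c d > 0" using fan H by (auto simp: convex_fan_def)
      ultimately show ?thesis using orthogonal_to_independent[of l c d] l0 by auto
    qed
  qed
qed

text \<open>In the basis of two independent isotropic vectors \<open>d\<close>, \<open>e\<close>, the form is a nonzero multiple of the
  product of the coordinates.\<close>

lemma bil_zeros_on_two_lines:
  assumes "\<not> (p = 0 \<and> r = 0 \<and> s = 0)"
  obtains d e where "d \<noteq> 0" "e \<noteq> 0" "\<And>v. bil p r s v v = 0 \<Longrightarrow> cross2 d v = 0 \<or> cross2 e v = 0"
proof (cases "\<exists>d e. bil p r s d d = 0 \<and> bil p r s e e = 0 \<and> cross2 d e \<noteq> 0")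
  case True
  then obtain d e where de: "bil p r s d d = 0" "bil p r s e e = 0" "cross2 d e \<noteq> 0" by blast
  have "cross2 d v = 0 \<or> cross2 e v = 0" if "bil p r s v v = 0" for v
  proof -
    have "(cross2 d e)^2 * bil p r s v v
       = (cross2 v e)^2 * bil p r s d d + 2 * cross2 v e * cross2 d v * bil p r s d e + (cross2 d v)^2 * bil p r s e e"
      by (simp add: cross2_def bil_def power2_eq_square algebra_simps)
    then have "cross2 v e * cross2 d v * bil p r s d e = 0" using de that by simp
    moreover have "bil p r s d e \<noteq> 0"
    proof
      assume 0: "bil p r s d e = 0"
      have all: "(cross2 d e)^2 * bil p r s x y = 0" for x y
      proof -
        have "(cross2 d e)^2 * bil p r s x y = cross2 x e * cross2 y e * bil p r s d d
          + (cross2 x e * cross2 d y + cross2 d x * cross2 y e) * bil p r s d e + cross2 d x * cross2 d y * bil p r s e e"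
          by (simp add: cross2_def bil_def power2_eq_square algebra_simps)
        then show ?thesis using de 0 by simp
      qed
      have "bil p r s (axis i 1) (axis j 1) = 0" for i j using all de(3) by simp
      from this[of 1 1] this[of 1 2] this[of 2 2] show False using assms
        by (simp add: bil_def axis_def)
    qed
    ultimately show ?thesis using cross2_skew[of v e] by auto
  qed
  moreover have "d \<noteq> 0" "e \<noteq> 0" using de by (auto simp: cross2_def)
  ultimately show ?thesis using that by blast
next
  case False
  show ?thesis
  proof (cases "\<exists>d. d \<noteq> 0 \<and> bil p r s d d = 0")
    case True
    then show ?thesis using False that by metis
  next
    case F: False
    have "(axis 1 1 :: real^2) \<noteq> 0" by (simp add: axis_eq_0_iff)
    then show ?thesis using that[of "axis 1 1" "axis 1 1"] F by (metis cross2_def mult_zero_right zero_index diff_self)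
  qed
qed

section \<open>Triangles, edges and vertices of a mesh\<close>

definition verts :: "(real^2) set \<Rightarrow> (real^2) set" where
  "verts T = {v. v extreme_point_of T}"

lemma verts_simplex:
  assumes "2 simplex T"
  shows "\<not> affine_dependent (verts T)" "card (verts T) = 3" "T = convex hull (verts T)" "finite (verts T)"
proof -
  obtain C where C: "\<not> affine_dependent C" "int (card C) = 2 + 1" "T = convex hull C"
    using assms by (auto simp: simplex_def)
  have "verts T = C"
    by (simp add: verts_def C(3) extreme_point_of_convex_hull_affine_independent[OF C(1)])
  then show "\<not> affine_dependent (verts T)" "card (verts T) = 3" "T = convex hull (verts T)" "finite (verts T)"
    using C aff_independent_finite by auto
qed

lemma mesh_simplex: "mesh_of \<Omega> \<T> \<Longrightarrow> T \<in> \<T> \<Longrightarrow> 2 simplex T"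
  by (simp add: mesh_of_def)

lemma verts_subset: "verts T \<subseteq> T"
  by (auto simp: verts_def extreme_point_of_def)

lemma cross2_eq_0_imp_collinear:
  assumes "cross2 (b - z) (c - z) = 0"
  shows "collinear {z, b, c}"
proof -
  let ?x = "b - z" and ?y = "c - z"
  have 1: "(?x \<bullet> ?x) *\<^sub>R ?y = (?x \<bullet> ?y) *\<^sub>R ?x + cross2 ?x ?y *\<^sub>R rot ?x"
    unfolding vec2_eq_iff by (simp add: cross2_def inner2 algebra_simps)
  have "collinear {0, ?x, ?y}"
  proof (cases "?x = 0")
    case False
    then have "?y = (1 / (?x \<bullet> ?x)) *\<^sub>R ((?x \<bullet> ?x) *\<^sub>R ?y)" by simp
    also have "\<dots> = ((?x \<bullet> ?y) / (?x \<bullet> ?x)) *\<^sub>R ?x" unfolding 1 assms by simp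
    finally show ?thesis by (auto simp: collinear_lemma)
  qed (simp add: collinear_lemma)
  then have "collinear {b, z, c}" by (subst collinear_3) auto
  then show ?thesis by (simp add: insert_commute)
qed

lemma simplex_vertices_cross2:
  assumes "2 simplex T" "{z, b, c} \<subseteq> verts T" "z \<noteq> b" "z \<noteq> c" "b \<noteq> c"
  shows "cross2 (b - z) (c - z) \<noteq> 0"
proof
  assume "cross2 (b - z) (c - z) = 0"
  then have "affine_dependent {z, b, c}"
    using cross2_eq_0_imp_collinear assms by (auto simp: collinear_3_eq_affine_dependent)
  then show False using verts_simplex(1)[OF assms(1)] assms(2) affine_dependent_subset by blast
qed

lemma simplex_third_vertex:
  assumes "2 simplex T" "z \<in> verts T" "b \<in> verts T" "z \<noteq> b"
  obtains c where "verts T = {z, b, c}" "c \<noteq> z" "c \<noteq> b" "cross2 (b - z) (c - z) \<noteq> 0"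
proof -
  note V = verts_simplex[OF assms(1)]
  have "card (verts T - {z, b}) = 1" using V(2,4) assms by (simp add: card_Diff_subset)
  then obtain c where c: "verts T - {z, b} = {c}" by (auto simp: card_1_singleton_iff)
  then have *: "verts T = {z, b, c}" "c \<noteq> z" "c \<noteq> b" using assms by auto
  then show ?thesis using that simplex_vertices_cross2[OF assms(1), of z b c] assms(4) by auto
qed

lemma simplex_edge_iff:
  assumes "2 simplex T"
  shows "e edge_of T \<longleftrightarrow> (\<exists>a\<in>verts T. \<exists>b\<in>verts T. a \<noteq> b \<and> e = closed_segment a b)"
proof
  note V = verts_simplex[OF assms]
  assume "e edge_of T"
  then have e: "e face_of convex hull (verts T)" "aff_dim e = 1" by (auto simp: edge_of_def simp flip: V(3))
  then obtain c where c: "c \<subseteq> verts T" "e = convex hull c"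
    using face_of_convex_hull_affine_independent[OF V(1)] by auto
  then have "\<not> affine_dependent c" using V(1) affine_dependent_subset by blast
  then have "card c = 2" using e(2) aff_dim_affine_independent[of c] by (simp add: c aff_dim_convex_hull)
  then obtain a b where "c = {a, b}" "a \<noteq> b" by (auto simp: card_2_iff)
  then show "\<exists>a\<in>verts T. \<exists>b\<in>verts T. a \<noteq> b \<and> e = closed_segment a b"
    using c by (auto simp: segment_convex_hull)
next
  note V = verts_simplex[OF assms]
  assume "\<exists>a\<in>verts T. \<exists>b\<in>verts T. a \<noteq> b \<and> e = closed_segment a b"
  then obtain a b where ab: "a \<in> verts T" "b \<in> verts T" "a \<noteq> b" "e = convex hull {a, b}"
    by (auto simp: segment_convex_hull)
  then have "e face_of convex hull (verts T)"
    unfolding face_of_convex_hull_affine_independent[OF V(1)] by (intro exI[of _ "{a, b}"]) simp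
  then show "e edge_of T" using ab unfolding V(3)[symmetric] by (auto simp: edge_of_def aff_dim_convex_hull)
qed

text \<open>Two members of the mesh meet in a common face.  A face of a triangle is the hull of some of its
  vertices, and these are determined by the face as its extreme points.\<close>

lemma mesh_inter:
  assumes "mesh_of \<Omega> \<T>" "T \<in> \<T>" "T' \<in> \<T>"
  shows "T \<inter> T' = convex hull (verts T \<inter> verts T')"
proof
  note V = verts_simplex[OF mesh_simplex[OF assms(1,2)]]
  note V' = verts_simplex[OF mesh_simplex[OF assms(1,3)]]
  have tri: "T \<inter> T' face_of T" "T' \<inter> T face_of T'" using assms by (auto simp: mesh_of_def triangulation_def)
  then obtain c c' where c: "c \<subseteq> verts T" "T \<inter> T' = convex hull c" and c': "c' \<subseteq> verts T'" "T' \<inter> T = convex hull c'"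
    using face_of_convex_hull_affine_independent[OF V(1)] face_of_convex_hull_affine_independent[OF V'(1)]
      V(3) V'(3) by metis
  have "\<not> affine_dependent c" "\<not> affine_dependent c'"
    using c(1) c'(1) V(1) V'(1) affine_dependent_subset by blast+
  then have "c = {v. v extreme_point_of convex hull c}" "c' = {v. v extreme_point_of convex hull c'}"
    by (simp_all add: extreme_point_of_convex_hull_affine_independent)
  then have "c = c'" using c(2) c'(2) by (metis Int_commute)
  then show "T \<inter> T' \<subseteq> convex hull (verts T \<inter> verts T')"
    using c c' by (metis Int_greatest hull_mono)
  have "convex hull (verts T \<inter> verts T') \<subseteq> convex hull (verts T)"
    "convex hull (verts T \<inter> verts T') \<subseteq> convex hull (verts T')" by (simp_all add: hull_mono)
  then show "convex hull (verts T \<inter> verts T') \<subseteq> T \<inter> T'" by (simp flip: V(3) V'(3))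
qed

lemma mesh_shared_vertex:
  assumes "mesh_of \<Omega> \<T>" "T \<in> \<T>" "T' \<in> \<T>" "v \<in> verts T" "v \<in> T'"
  shows "v \<in> verts T'"
proof -
  have "v \<in> T" using assms verts_subset by blast
  have "v extreme_point_of (T \<inter> T')"
    using assms \<open>v \<in> T\<close> by (auto simp: verts_def extreme_point_of_def)
  then have "v extreme_point_of (convex hull (verts T \<inter> verts T'))" using mesh_inter[OF assms(1-3)] by simp
  then show ?thesis using extreme_point_of_convex_hull by blast
qed

lemma mesh_shared_edge:
  assumes "mesh_of \<Omega> \<T>" "T \<in> \<T>" "T' \<in> \<T>" "a \<in> verts T" "b \<in> verts T" "y \<in> open_segment a b" "y \<in> T'"
  shows "a \<in> verts T'" "b \<in> verts T'"
proof -
  have face: "T \<inter> T' face_of T" using assms by (auto simp: mesh_of_def triangulation_def)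
  have ab: "a \<in> T" "b \<in> T" using assms verts_subset by blast+
  have "convex T" using verts_simplex(3)[OF mesh_simplex[OF assms(1,2)]] convex_convex_hull by metis
  then have "y \<in> T" using ab assms(6) by (meson convex_contains_open_segment subsetD)
  then have "a \<in> T \<inter> T'" "b \<in> T \<inter> T'" using face ab assms(6,7) unfolding face_of_def by blast+
  then show "a \<in> verts T'" "b \<in> verts T'" using mesh_shared_vertex[OF assms(1-3)] assms(4,5) by auto
qed

lemma mesh_edges_segment_iff:
  assumes "mesh_of \<Omega> \<T>"
  shows "closed_segment a b \<in> mesh_edges \<T> \<longleftrightarrow> a \<noteq> b \<and> (\<exists>T\<in>\<T>. a \<in> verts T \<and> b \<in> verts T)"
proof
  assume "closed_segment a b \<in> mesh_edges \<T>"
  then obtain T where T: "T \<in> \<T>" "closed_segment a b edge_of T" by (auto simp: mesh_edges_def)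
  then obtain c d where "c \<in> verts T" "d \<in> verts T" "c \<noteq> d" "closed_segment a b = closed_segment c d"
    using simplex_edge_iff[OF mesh_simplex[OF assms T(1)]] by auto
  then show "a \<noteq> b \<and> (\<exists>T\<in>\<T>. a \<in> verts T \<and> b \<in> verts T)" using T by (auto simp: doubleton_eq_iff)
next
  assume "a \<noteq> b \<and> (\<exists>T\<in>\<T>. a \<in> verts T \<and> b \<in> verts T)"
  then show "closed_segment a b \<in> mesh_edges \<T>"
    using simplex_edge_iff[OF mesh_simplex[OF assms]] by (auto simp: mesh_edges_def) 
qed

lemma patch_edges_segment:
  assumes "mesh_of \<Omega> \<T>" "T \<in> patch_triangles \<T> W" "a \<in> verts T" "b \<in> verts T" "a \<noteq> b"
  shows "closed_segment a b \<in> patch_edges \<T> W"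
proof -
  have T: "T \<in> \<T>" "T \<subseteq> W" using assms by (auto simp: patch_triangles_def)
  have "convex T" using verts_simplex(3)[OF mesh_simplex[OF assms(1) T(1)]] convex_convex_hull by metis
  then have "closed_segment a b \<subseteq> W" using assms(3,4) T(2) verts_subset
    by (meson closed_segment_subset dual_order.trans subsetD)
  then show ?thesis using mesh_edges_segment_iff[OF assms(1)] T assms by (auto simp: patch_edges_def)
qed

lemma patch_vertices_iff:
  assumes mesh: "mesh_of \<Omega> \<T>" and W: "W = \<Union>(patch_triangles \<T> W)"
  shows "v \<in> patch_vertices \<T> W \<longleftrightarrow> (\<exists>T\<in>patch_triangles \<T> W. v \<in> verts T)"
proof
  assume v: "v \<in> patch_vertices \<T> W"
  then obtain T where T: "T \<in> \<T>" "v \<in> verts T" by (auto simp: patch_vertices_def mesh_vertices_def verts_def)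
  from v W obtain T' where "T' \<in> patch_triangles \<T> W" "v \<in> T'" by (auto simp: patch_vertices_def)
  then show "\<exists>T\<in>patch_triangles \<T> W. v \<in> verts T"
    using mesh_shared_vertex[OF mesh T(1) _ T(2)] by (auto simp: patch_triangles_def)
next
  assume "\<exists>T\<in>patch_triangles \<T> W. v \<in> verts T"
  then show "v \<in> patch_vertices \<T> W" using verts_subset
    by (auto simp: patch_vertices_def mesh_vertices_def verts_def patch_triangles_def)
qed

lemma vertex_patch_triangles:
  assumes "vertex_patch \<T> z W"
  shows "W = \<Union>(patch_triangles \<T> W)" "T \<in> \<T> \<Longrightarrow> z \<in> verts T \<Longrightarrow> T \<in> patch_triangles \<T> W"
  using assms by (auto simp: vertex_patch_def patch_triangles_def verts_def)

lemma convex_hull_3_cross2: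
  assumes "y \<in> convex hull {z, b, c}"
  obtains t where "t \<ge> 0" "cross2 (b - z) (y - z) = t * cross2 (b - z) (c - z)"
proof -
  obtain u v w where y: "y = u *\<^sub>R z + v *\<^sub>R b + w *\<^sub>R c" "0 \<le> w" "u + v + w = 1"
    using assms by (auto simp: convex_hull_3)
  have u: "u = 1 - v - w" using y by simp
  have "cross2 (b - z) (y - z) = w * cross2 (b - z) (c - z)"
    unfolding y(1) u by (simp add: cross2_def algebra_simps)
  then show ?thesis using y(2) that by blast
qed

text \<open>Look at a point slightly to the left of the edge \<open>zb\<close>.  It belongs to \<open>\<Omega>\<close>, so some triangle contains
  it; if the point is close enough to the edge, this triangle contains points of the edge itself, hence
  the whole edge.\<close>

lemma mesh_successor:
  assumes mesh: "mesh_of \<Omega> \<T>" and "open \<Omega>" "z \<in> \<Omega>"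
    and T0: "T0 \<in> \<T>" "z \<in> verts T0" "b \<in> verts T0" "z \<noteq> b"
  obtains T c where "T \<in> \<T>" "verts T = {z, b, c}" "cross2 (b - z) (c - z) > 0"
proof -
  have closedT: "closed T" if "T \<in> \<T>" for T
    using verts_simplex(3,4)[OF mesh_simplex[OF mesh that]] finite_imp_compact_convex_hull compact_imp_closed
    by metis
  have "((\<lambda>t. z + t *\<^sub>R (b - z)) \<longlongrightarrow> z + 0 *\<^sub>R (b - z)) (at_right 0)"
    by (intro tendsto_intros)
  then have "\<forall>\<^sub>F t in at_right 0. z + t *\<^sub>R (b - z) \<in> \<Omega>"
    using \<open>open \<Omega>\<close> \<open>z \<in> \<Omega>\<close> topological_tendstoD[of _ "z + 0 *\<^sub>R (b - z)"] by fastforce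
  moreover have "\<forall>\<^sub>F t::real in at_right 0. t \<in> {0<..<1}"
    by (rule eventually_at_right_real) simp
  ultimately obtain t where t: "0 < t" "t < 1" "z + t *\<^sub>R (b - z) \<in> \<Omega>"
    using eventually_happens'[OF _ eventually_conj] by (metis (no_types, lifting) greaterThanLessThan_iff trivial_limit_at_right_real)
  define y where "y = z + t *\<^sub>R (b - z)"
  have yseg: "y \<in> open_segment z b" using t T0(4) by (auto simp: y_def in_segment algebra_simps intro!: exI[of _ t])
  \<comment> \<open>In \<open>U\<close> there are only triangles through \<open>y\<close>; it is a neighbourhood because there are finitely many.\<close>
  define U where "U = \<Omega> - \<Union>{T\<in>\<T>. y \<notin> T}"
  have "finite \<T>" using mesh by (auto simp: mesh_of_def triangulation_def)
  then have "open U" unfolding U_def using \<open>open \<Omega>\<close> closedT by (intro open_Diff closed_Union) auto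
  moreover have "y \<in> U" using t by (auto simp: U_def y_def)
  moreover have "((\<lambda>\<epsilon>. y + \<epsilon> *\<^sub>R rot (b - z)) \<longlongrightarrow> y + 0 *\<^sub>R rot (b - z)) (at_right 0)"
    by (intro tendsto_intros)
  ultimately have "\<forall>\<^sub>F \<epsilon> in at_right 0. y + \<epsilon> *\<^sub>R rot (b - z) \<in> U"
    using topological_tendstoD[of _ "y + 0 *\<^sub>R rot (b - z)"] by fastforce
  moreover have "\<forall>\<^sub>F \<epsilon>::real in at_right 0. \<epsilon> \<in> {0<..<1}"
    by (rule eventually_at_right_real) simp
  ultimately obtain \<epsilon> where \<epsilon>: "\<epsilon> > 0" "y + \<epsilon> *\<^sub>R rot (b - z) \<in> U"
    using eventually_happens'[OF _ eventually_conj] by (metis (no_types, lifting) greaterThanLessThan_iff trivial_limit_at_right_real)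
  define y' where "y' = y + \<epsilon> *\<^sub>R rot (b - z)"
  have "\<Omega> \<subseteq> \<Union>\<T>" using mesh closure_subset by (auto simp: mesh_of_def)
  then obtain T where T: "T \<in> \<T>" "y' \<in> T" "y \<in> T" using \<epsilon> by (auto simp: U_def y'_def)
  have zb: "z \<in> verts T" "b \<in> verts T" using mesh_shared_edge[OF mesh T0(1) T(1) T0(2,3) yseg T(3)] by auto
  obtain c where c: "verts T = {z, b, c}" "cross2 (b - z) (c - z) \<noteq> 0"
    using simplex_third_vertex[OF mesh_simplex[OF mesh T(1)] zb T0(4)] by metis
  have "y' \<in> convex hull {z, b, c}" using T(2) verts_simplex(3)[OF mesh_simplex[OF mesh T(1)]] c(1) by metis
  then obtain w where w: "w \<ge> 0" "cross2 (b - z) (y' - z) = w * cross2 (b - z) (c - z)"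
    using convex_hull_3_cross2 by metis
  have "cross2 (b - z) (y' - z) = \<epsilon> * ((b - z) \<bullet> (b - z))"
    by (simp add: y'_def y_def cross2_def inner2 algebra_simps)
  moreover have "(b - z) \<bullet> (b - z) > 0" using T0(4) by simp
  ultimately have "w * cross2 (b - z) (c - z) > 0" using \<epsilon> w by simp
  then have "cross2 (b - z) (c - z) > 0" using w(1) by (simp add: zero_less_mult_iff)
  then show ?thesis using that T(1) c(1) by blast
qed

text \<open>The nearer one of two neighbours on a ray would be a point of the edge to the other one, and by
  conformity a third vertex, collinear with \<open>z\<close> and \<open>v\<close>, of the same triangle.\<close>

lemma mesh_spoke_unique_aux:
  assumes mesh: "mesh_of \<Omega> \<T>" and T: "T \<in> \<T>" "z \<in> verts T" "v \<in> verts T" "z \<noteq> v"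
    and T': "T' \<in> \<T>" "w \<in> verts T'" and k: "0 < k" "k \<le> 1" "w - z = k *\<^sub>R (v - z)"
  shows "w = v"
proof (rule ccontr)
  assume "w \<noteq> v"
  have w: "w = (1 - k) *\<^sub>R z + k *\<^sub>R v" using k(3) by (simp add: algebra_simps)
  have "convex T" using verts_simplex(3)[OF mesh_simplex[OF mesh T(1)]] convex_convex_hull by metis
  then have "w \<in> T" unfolding w using T k verts_subset by (intro convexD) auto
  then have "w \<in> verts T" using mesh_shared_vertex[OF mesh T'(1) T(1) T'(2)] by simp
  moreover have "w \<noteq> z" using k T(4) by auto
  ultimately have "cross2 (v - z) (w - z) \<noteq> 0"
    using simplex_vertices_cross2[OF mesh_simplex[OF mesh T(1)], of z v w] T \<open>w \<noteq> v\<close> by auto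
  then show False unfolding k(3) by (simp add: cross2_def)
qed

lemma mesh_spoke_unique:
  assumes mesh: "mesh_of \<Omega> \<T>" and T: "T \<in> \<T>" "z \<in> verts T" "v \<in> verts T" "z \<noteq> v"
    and T': "T' \<in> \<T>" "z \<in> verts T'" "w \<in> verts T'" "z \<noteq> w" and k: "0 < k" "w - z = k *\<^sub>R (v - z)"
  shows "w = v"
proof (cases "k \<le> 1")
  case True
  then show ?thesis using mesh_spoke_unique_aux[OF mesh T T'(1,3)] k by auto
next
  case False
  then have "0 < 1 / k" "1 / k \<le> 1" "v - z = (1 / k) *\<^sub>R (w - z)" using k by auto
  then show ?thesis using mesh_spoke_unique_aux[OF mesh T' T(1,3)] by metis
qed

section \<open>The fan of triangles around a vertex\<close>

text \<open>By the addition theorem, the sine of the sum of the two angles is a positive multiple of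
  \<open>cross2 (a - v) (c - v)\<close>.\<close>

lemma angle_sum_imp_cross2_nonneg:
  assumes ab: "cross2 (a - v) (b - v) > 0" and bc: "cross2 (b - v) (c - v) > 0"
    and sum: "angle_at v a b + angle_at v b c \<le> pi"
  shows "cross2 (a - v) (c - v) \<ge> 0"
proof -
  define x y w where "x = a - v" and "y = b - v" and "w = c - v"
  have pos: "cross2 x y > 0" "cross2 y w > 0" using ab bc by (auto simp: x_def y_def w_def)
  then have nz: "x \<noteq> 0" "y \<noteq> 0" "w \<noteq> 0" by (auto simp: cross2_def)
  have trig: "cos (arccos (s \<bullet> t / (norm s * norm t))) = s \<bullet> t / (norm s * norm t)
      \<and> sin (arccos (s \<bullet> t / (norm s * norm t))) = cross2 s t / (norm s * norm t)
      \<and> 0 \<le> arccos (s \<bullet> t / (norm s * norm t))"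
    if "cross2 s t > 0" for s t :: "real^2"
  proof -
    have st: "s \<noteq> 0" "t \<noteq> 0" using that by (auto simp: cross2_def)
    define q where "q = s \<bullet> t / (norm s * norm t)"
    \<comment> \<open>Lagrange's identity\<close>
    have lag: "(s \<bullet> t)^2 + (cross2 s t)^2 = (norm s)^2 * (norm t)^2"
      unfolding power2_norm_eq_inner by (simp add: cross2_def inner2 power2_eq_square algebra_simps)
    have "1 - q^2 = (cross2 s t / (norm s * norm t))^2"
      using lag st by (simp add: q_def power_divide power_mult_distrib field_simps)
    moreover have q: "-1 \<le> q" "q \<le> 1" using Cauchy_Schwarz_ineq2[of s t] st
      by (auto simp: q_def field_simps abs_le_iff)
    ultimately have "sin (arccos q) = cross2 s t / (norm s * norm t)"
      using that st by (simp add: sin_arccos)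
    then show ?thesis using q by (auto simp: q_def[symmetric] arccos_lbound cos_arccos)
  qed
  define A B where "A = angle_at v a b" and "B = angle_at v b c"
  have A: "cos A = x \<bullet> y / (norm x * norm y)" "sin A = cross2 x y / (norm x * norm y)" "0 \<le> A"
    using trig[OF pos(1)] by (auto simp: A_def angle_at_def x_def y_def)
  have B: "cos B = y \<bullet> w / (norm y * norm w)" "sin B = cross2 y w / (norm y * norm w)" "0 \<le> B"
    using trig[OF pos(2)] by (auto simp: B_def angle_at_def w_def y_def)
  have "0 \<le> sin (A + B)" using A(3) B(3) sum by (intro sin_ge_zero) (auto simp: A_def B_def)
  also have "sin (A + B) = (cross2 x y * (y \<bullet> w) + (x \<bullet> y) * cross2 y w) / (norm x * norm y * norm y * norm w)"
    unfolding sin_add A B using nz by (simp add: field_simps)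
  also have "cross2 x y * (y \<bullet> w) + (x \<bullet> y) * cross2 y w = cross2 x w * (y \<bullet> y)"
    by (simp add: cross2_def inner2 algebra_simps)
  finally have "0 \<le> cross2 x w * (y \<bullet> y) / (norm x * norm y * norm y * norm w)" .
  moreover have "norm x * norm y * norm y * norm w > 0" using nz by simp
  ultimately have "0 \<le> cross2 x w * (y \<bullet> y)" by (simp only: zero_le_divide_iff) linarith
  moreover have "y \<bullet> y > 0" using nz by simp
  ultimately have "0 \<le> cross2 x w" by (simp only: zero_le_mult_iff) linarith
  then show ?thesis by (simp add: x_def w_def)
qed

lemma adjacent_triangles_cross2:
  assumes mesh: "mesh_of \<Omega> \<T>" and ang: "adjacent_angle_condition \<T> W"
    and T: "T \<in> patch_triangles \<T> W" "verts T = {v, a, b}"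
    and T': "T' \<in> patch_triangles \<T> W" "verts T' = {v, b, c}"
    and pos: "cross2 (a - v) (b - v) > 0" "cross2 (b - v) (c - v) > 0"
  shows "cross2 (a - v) (c - v) \<ge> 0"
proof -
  have hull: "T = convex hull {v, a, b}" "T' = convex hull {v, b, c}"
    using verts_simplex(3)[OF mesh_simplex[OF mesh]] T T' unfolding patch_triangles_def by (metis (mono_tags, lifting) mem_Collect_eq)+
  have "cross2 (c - v) (b - v) < 0" using pos(2) cross2_skew[of "c - v" "b - v"] by simp
  moreover have "cross2 (v - v) (b - v) = 0" by (simp add: cross2_def)
  ultimately have "a \<notin> {v, b, c}" using pos(1) by auto
  then have "T \<noteq> T'" using T(2) T'(2) by auto
  then have "angle_at v a b + angle_at v b c \<le> pi"
    using ang T(1) T'(1) unfolding hull adjacent_angle_condition_def by blast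
  then show ?thesis using angle_sum_imp_cross2_nonneg pos by blast
qed

definition spoke_ends :: "(real^2) set set \<Rightarrow> real^2 \<Rightarrow> (real^2) set" where
  "spoke_ends \<T> z = {v. \<exists>T\<in>\<T>. z \<in> verts T \<and> v \<in> verts T \<and> v \<noteq> z}"

text \<open>The angle condition at \<open>z\<close> gives the lower bound in the definition of a convex fan.  The one at a
  neighbour, applied to the same two triangles, gives the upper bound.\<close>

lemma convex_fan_of_patch:
  assumes mesh: "mesh_of \<Omega> \<T>" and "open \<Omega>" "z \<in> \<Omega>" and patch: "vertex_patch \<T> z W"
    and ang: "adjacent_angle_condition \<T> W" and ne: "spoke_ends \<T> z \<noteq> {}"
  shows "convex_fan ((\<lambda>v. v - z) ` spoke_ends \<T> z)
      (\<lambda>u v. \<exists>T\<in>\<T>. verts T = {z, z + u, z + v} \<and> cross2 u v > 0)"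
    (is "convex_fan ?N ?R")
proof -
  have "finite (\<Union>T\<in>\<T>. verts T)"
    using mesh verts_simplex(4) mesh_simplex[OF mesh] by (auto simp: mesh_of_def triangulation_def)
  then have fin: "finite (spoke_ends \<T> z)"
    by (rule finite_subset[rotated]) (auto simp: spoke_ends_def)
  have succ: "\<exists>c\<in>?N. ?R b c" if "b \<in> ?N" for b
  proof -
    obtain v T where v: "b = v - z" "T \<in> \<T>" "z \<in> verts T" "v \<in> verts T" "z \<noteq> v"
      using \<open>b \<in> ?N\<close> by (auto simp: spoke_ends_def)
    obtain T' c where T': "T' \<in> \<T>" "verts T' = {z, v, c}" "cross2 (v - z) (c - z) > 0"
      using mesh_successor[OF mesh assms(2,3) v(2-5)] by metis
    then have "c \<noteq> z" by (auto simp: cross2_def)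
    then have "c - z \<in> ?N" using T' by (auto simp: spoke_ends_def)
    moreover have "?R b (c - z)" using T' v(1) by auto
    ultimately show ?thesis by blast
  qed
  have adj: "0 \<le> cross2 a c \<and> cross2 a c \<le> cross2 a b + cross2 b c" if "?R a b" "?R b c" for a b c
  proof -
    obtain T T' where T: "T \<in> \<T>" "verts T = {z, z + a, z + b}" "cross2 a b > 0"
      and T': "T' \<in> \<T>" "verts T' = {z, z + b, z + c}" "cross2 b c > 0" using \<open>?R a b\<close> \<open>?R b c\<close> by blast
    have P: "T \<in> patch_triangles \<T> W" "T' \<in> patch_triangles \<T> W"
      using vertex_patch_triangles(2)[OF patch] T T' by auto
    have "0 \<le> cross2 (z + a - z) (z + c - z)"
      using adjacent_triangles_cross2[OF mesh ang P(1) T(2) P(2) T'(2)] T T' by simp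
    moreover have "0 \<le> cross2 (z + c - (z + b)) (z + a - (z + b))"
    proof (rule adjacent_triangles_cross2[OF mesh ang P(2) _ P(1)])
      show "verts T' = {z + b, z + c, z}" "verts T = {z + b, z, z + a}" using T T' by auto
      show "cross2 (z + c - (z + b)) (z - (z + b)) > 0" "cross2 (z - (z + b)) (z + a - (z + b)) > 0"
        using T(3) T'(3) by (simp_all add: cross2_def algebra_simps)
    qed
    ultimately show ?thesis by (simp add: cross2_def algebra_simps)
  qed
  show ?thesis unfolding convex_fan_def using fin ne succ adj by blast
qed

section \<open>Propagation through a Lipschitz patch\<close>

text \<open>Near a boundary point the set is an epigraph.  Two points of the epigraph close to \<open>x\<close> can be
  joined inside it by moving up to a common height, above the graph, and then horizontally.  The path
  avoids \<open>x\<close>, which lies on the graph, because points below \<open>x\<close> are outside of the epigraph.\<close>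

lemma punctured_lipschitz_neighbourhood:
  assumes W: "closed W" "lipschitz_boundary W" and x: "x \<in> W" and "0 < r0"
  obtains \<delta> where "\<delta> > 0"
    "\<And>p q. p \<in> W \<Longrightarrow> q \<in> W \<Longrightarrow> p \<noteq> x \<Longrightarrow> q \<noteq> x \<Longrightarrow> dist x p < \<delta> \<Longrightarrow> dist x q < \<delta> \<Longrightarrow>
       \<exists>C. connected C \<and> p \<in> C \<and> q \<in> C \<and> C \<subseteq> W \<inter> ball x r0 - {x}"
proof (cases "x \<in> interior W")
  case True
  then obtain e where e: "e > 0" "ball x e \<subseteq> W" by (auto simp: mem_interior)
  define \<delta> where "\<delta> = min e r0"
  have "connected (ball x \<delta> - {x})" by (rule connected_punctured_ball) simp
  moreover have "ball x \<delta> - {x} \<subseteq> W \<inter> ball x r0 - {x}" using e by (auto simp: \<delta>_def)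
  moreover have "\<delta> > 0" using e \<open>0 < r0\<close> by (simp add: \<delta>_def)
  ultimately show ?thesis using that[of \<delta>] by (metis DiffI mem_ball singletonD)
next
  case False
  then have "x \<in> frontier W" using x W(1) by (simp add: frontier_def)
  then obtain r L and f :: "real^2 \<Rightarrow> real^2" and \<phi> :: "real \<Rightarrow> real" where r: "r > 0" and f: "orthogonal_transformation f" and lip: "L-lipschitz_on UNIV \<phi>"
    and epi: "\<And>p. p \<in> ball x r \<Longrightarrow> p \<in> W \<longleftrightarrow> \<phi> (f (p - x) $ 1) \<le> f (p - x) $ 2"
    using W(2) unfolding lipschitz_boundary_def by blast
  have linf: "linear f" using f by (simp add: orthogonal_transformation)
  have f0: "f 0 = 0" using linf by (rule linear_0)
  have L0: "L \<ge> 0" using lip by (simp add: lipschitz_on_def)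
  have contf: "continuous_on UNIV f" using linf by (simp add: linear_continuous_on linear_linear)
  have cont\<phi>: "continuous_on UNIV \<phi>" using lip by (rule lipschitz_on_continuous_on)
  have "\<phi> 0 \<le> 0" using epi[of x] x r f0 by simp
  \<comment> \<open>Otherwise \<open>x\<close> would lie strictly inside the epigraph.\<close>
  moreover have "\<not> \<phi> 0 < 0"
  proof
    assume neg: "\<phi> 0 < 0"
    define U where "U = {p. \<phi> (f (p - x) $ 1) < f (p - x) $ 2} \<inter> ball x r"
    have "continuous_on UNIV (\<lambda>p. f (p - x))"
      by (intro continuous_on_compose2[OF contf] continuous_intros) auto
    then have "open {p. \<phi> (f (p - x) $ 1) < f (p - x) $ 2}"
      by (intro open_Collect_less continuous_on_compose2[OF cont\<phi>] continuous_intros) auto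
    then have "open U" by (simp add: U_def open_Int)
    moreover have "x \<in> U" using neg f0 r by (simp add: U_def)
    moreover have "U \<subseteq> W" using epi by (auto simp: U_def)
    ultimately show False using False interiorI by blast
  qed
  ultimately have \<phi>0: "\<phi> 0 = 0" by simp
  \<comment> \<open>At height \<open>h\<close> the paths are above the graph, whose slope is at most \<open>L\<close>, and \<open>\<delta> + h\<close> bounds their distance to \<open>x\<close>.\<close>
  define \<rho> where "\<rho> = min r r0"
  define \<delta> where "\<delta> = \<rho> / (L + 2)"
  define h where "h = (L + 1) * \<delta>"
  have \<rho>: "\<rho> > 0" "\<rho> \<le> r" "\<rho> \<le> r0" using r \<open>0 < r0\<close> by (auto simp: \<rho>_def)
  have \<delta>: "\<delta> > 0" using \<rho> L0 by (simp add: \<delta>_def)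
  have h: "h > 0" "\<delta> \<le> h" "L * \<delta> \<le> h" "\<delta> + h = \<rho>"
  proof -
    have "(L + 2) * \<delta> = \<rho>" using L0 by (simp add: \<delta>_def)
    then show "\<delta> + h = \<rho>" by (simp add: h_def algebra_simps)
    show "h > 0" using \<delta> L0 by (simp add: h_def)
    have "L * \<delta> \<ge> 0" using \<delta> L0 by simp
    then show "\<delta> \<le> h" "L * \<delta> \<le> h" using \<delta> by (auto simp: h_def algebra_simps)
  qed
  define E where "E = {y::real^2. \<bar>y$1\<bar> < \<delta> \<and> \<bar>y$2\<bar> \<le> h \<and> \<phi> (y$1) \<le> y$2 \<and> y \<noteq> 0}"
  define M where "M = {y::real^2. \<bar>y$1\<bar> < \<delta> \<and> y$2 = h}"
  have ME: "M \<subseteq> E"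
  proof
    fix y assume y: "y \<in> M"
    have "\<phi> (y$1) \<le> L * \<bar>y$1\<bar>" using lipschitz_onD[OF lip, of "y$1" 0] \<phi>0 by (simp add: dist_real_def)
    also have "\<dots> \<le> L * \<delta>" using y L0 by (auto simp: M_def intro!: mult_left_mono)
    also have "\<dots> \<le> h" by (rule h)
    finally show "y \<in> E" using y h by (auto simp: M_def E_def)
  qed
  have "M = {y::real^2. y$1 < \<delta>} \<inter> {y. - \<delta> < y$1} \<inter> {y. y$2 = h}" by (auto simp: M_def)
  moreover have "convex {y::real^2. y$1 < \<delta>}" "convex {y::real^2. - \<delta> < y$1}" "convex {y::real^2. y$2 = h}"
    using convex_halfspace_lt[of "axis 1 1 :: real^2" \<delta>] convex_halfspace_gt[of "- \<delta>" "axis 1 1 :: real^2"]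
      convex_hyperplane[of "axis 2 1 :: real^2" h] by (simp_all add: inner_axis' )
  ultimately have "convex M" by (simp add: convex_Int)
  define S where "S y = closed_segment y (vector [y$1, h]) \<union> M" for y :: "real^2"
  have S: "connected (S y)" "S y \<subseteq> E" "y \<in> S y" if y: "y \<in> E" for y
  proof -
    have "vector [y$1, h] \<in> closed_segment y (vector [y$1, h]) \<inter> M" using y by (simp add: M_def E_def)
    then show "connected (S y)" unfolding S_def using \<open>convex M\<close>
      by (intro connected_Un convex_connected convex_closed_segment) auto
    have "v \<in> E" if v: "v \<in> closed_segment y (vector [y$1, h])" for v
    proof -
      obtain t where t: "0 \<le> t" "t \<le> 1" "v = (1 - t) *\<^sub>R y + t *\<^sub>R vector [y$1, h]"
        using v by (auto simp: in_segment)
      have v1: "v$1 = y$1" by (simp add: t(3) algebra_simps)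
      have v2: "v$2 = y$2 + t * (h - y$2)" by (simp add: t(3) algebra_simps)
      have hy: "h - y$2 \<ge> 0" using y by (auto simp: E_def)
      have "t * (h - y$2) \<ge> 0" "t * (h - y$2) \<le> h - y$2"
        using t hy by (auto intro: mult_nonneg_nonneg mult_left_le_one_le)
      then have b: "y$2 \<le> v$2" "v$2 \<le> h" by (auto simp: v2)
      have "v \<noteq> 0"
      proof
        assume "v = 0"
        then have "y$1 = 0" "y$2 \<le> 0" using v1 b by auto
        moreover then have "y$2 \<ge> 0" using y \<phi>0 by (auto simp: E_def)
        ultimately show False using y by (auto simp: E_def vec2_eq_iff)
      qed
      then show "v \<in> E" using y v1 b by (auto simp: E_def)
    qed
    then show "S y \<subseteq> E" using ME by (auto simp: S_def)
    show "y \<in> S y" by (simp add: S_def)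
  qed
  define P where "P y = x + inv f y" for y
  have bij: "bij f" using f by (rule orthogonal_transformation_bij)
  have fP: "f (P y - x) = y" for y using bij by (simp add: P_def bij_is_surj surj_f_inv_f)
  have Pf: "P (f (p - x)) = p" for p using bij by (simp add: P_def bij_is_inj)
  have "orthogonal_transformation (inv f)" using f by (rule orthogonal_transformation_inv)
  then have "linear (inv f)" by (simp add: orthogonal_transformation)
  then have contP: "continuous_on A P" for A unfolding P_def
    by (intro continuous_intros) (simp add: linear_continuous_on linear_linear)
  have EP: "P y \<in> W \<inter> ball x r0 - {x}" if y: "y \<in> E" for y
  proof -
    have "norm (P y - x) = norm y" using orthogonal_transformation_norm[OF f, of "P y - x"] fP by simp
    also have "\<dots> \<le> \<bar>y$1\<bar> + \<bar>y$2\<bar>" using norm_le_l1_cart[of y] by (simp add: sum_2)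
    also have "\<dots> < \<rho>" using y h by (auto simp: E_def)
    finally have n: "dist x (P y) < \<rho>" by (simp add: dist_norm norm_minus_commute)
    then have "P y \<in> ball x r" using \<rho> by auto
    then have "P y \<in> W" using epi[of "P y"] y fP by (auto simp: E_def)
    moreover have "P y \<noteq> x" using fP[of y] f0 y by (auto simp: E_def)
    ultimately show ?thesis using n \<rho> by auto
  qed
  have fE: "f (p - x) \<in> E" if p: "p \<in> W" "p \<noteq> x" "dist x p < \<delta>" for p
  proof -
    have n: "norm (f (p - x)) < \<delta>" using orthogonal_transformation_norm[OF f] p by (simp add: dist_norm norm_minus_commute)
    have c: "\<bar>f (p - x) $ i\<bar> < \<delta>" for i using component_le_norm_cart[of "f (p - x)" i] n by linarith
    have "\<delta> \<le> \<rho>" using h by simp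
    then have "p \<in> ball x r" using p \<rho> by auto
    then have "\<phi> (f (p - x) $ 1) \<le> f (p - x) $ 2" using epi p by blast
    moreover have "f (p - x) \<noteq> 0" using Pf[of p] p(2) fP[of x] f0 bij by (metis bij_is_inj injD right_minus_eq)
    ultimately show ?thesis using c[of 1] c[of 2] h by (auto simp: E_def)
  qed
  show ?thesis
  proof (rule that[OF \<delta>])
    fix p q assume pq: "p \<in> W" "q \<in> W" "p \<noteq> x" "q \<noteq> x" "dist x p < \<delta>" "dist x q < \<delta>"
    define C where "C = P ` (S (f (p - x)) \<union> S (f (q - x)))"
    have "vector [0, h] \<in> M" using \<delta> by (simp add: M_def)
    then have "S (f (p - x)) \<inter> S (f (q - x)) \<noteq> {}" by (auto simp: S_def)
    then have "connected (S (f (p - x)) \<union> S (f (q - x)))"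
      using S(1) fE pq by (intro connected_Un) auto
    then have "connected C" unfolding C_def by (intro connected_continuous_image contP)
    moreover have "p \<in> C" "q \<in> C" unfolding C_def using S(3) fE pq Pf by (metis UnI1 UnI2 image_eqI)+
    moreover have "C \<subseteq> W \<inter> ball x r0 - {x}" unfolding C_def using S(2) fE pq EP by blast
    ultimately show "\<exists>C. connected C \<and> p \<in> C \<and> q \<in> C \<and> C \<subseteq> W \<inter> ball x r0 - {x}" by blast
  qed
qed

text \<open>Connectedness yields a common point \<open>x\<close> of \<open>A\<close> and \<open>B\<close>.  Points of \<open>A\<close> and \<open>B\<close> close to \<open>x\<close> can be joined
  within the set without passing through \<open>x\<close>, so \<open>A\<close> and \<open>B\<close> have another common point, arbitrarily
  close to \<open>x\<close>.\<close>

lemma lipschitz_no_finite_cut: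
  assumes W: "closed W" "connected W" "lipschitz_boundary W"
    and AB: "closed A" "closed B" "A \<union> B = W" "A \<noteq> {}" "B \<noteq> {}" "finite (A \<inter> B)"
    and lim: "\<And>x. x \<in> A \<inter> B \<Longrightarrow> x islimpt A \<and> x islimpt B"
  shows False
proof -
  have "A \<inter> B \<noteq> {}" using W(2) AB unfolding connected_closed by blast
  then obtain x where x: "x \<in> A" "x \<in> B" by blast
  obtain r0 where r0: "r0 > 0" "\<forall>y\<in>A \<inter> B. y \<noteq> x \<longrightarrow> r0 \<le> dist x y"
    using finite_set_avoid[OF AB(6)] by blast
  obtain \<delta> where \<delta>: "\<delta> > 0"
    "\<And>p q. p \<in> W \<Longrightarrow> q \<in> W \<Longrightarrow> p \<noteq> x \<Longrightarrow> q \<noteq> x \<Longrightarrow> dist x p < \<delta> \<Longrightarrow> dist x q < \<delta> \<Longrightarrow>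
       \<exists>C. connected C \<and> p \<in> C \<and> q \<in> C \<and> C \<subseteq> W \<inter> ball x r0 - {x}"
    using punctured_lipschitz_neighbourhood[OF W(1,3) _ r0(1), of x] x AB(3) by blast
  obtain p q where "p \<in> A" "p \<noteq> x" "dist x p < \<delta>" and "q \<in> B" "q \<noteq> x" "dist x q < \<delta>"
    using lim[of x] x \<delta>(1) unfolding islimpt_approachable by (metis IntI dist_commute)
  then obtain C where C: "connected C" "p \<in> A \<inter> C" "q \<in> B \<inter> C" "C \<subseteq> W \<inter> ball x r0 - {x}"
    using \<delta>(2)[of p q] AB(3) by blast
  then have "A \<inter> B \<inter> C \<noteq> {}" using AB(1-3) unfolding connected_closed by blast
  then show False using C(4) r0(2) by force
qed

text \<open>Separate the triangles all of whose vertices have the property from the others.  A triangle of one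
  kind shares at most one vertex with a triangle of the other kind, so the two unions have a finite
  intersection.\<close>

lemma patch_vertex_propagation:
  assumes mesh: "mesh_of \<Omega> \<T>" and patch: "vertex_patch \<T> z W"
    and T0: "T0 \<in> patch_triangles \<T> W" "\<And>v. v \<in> verts T0 \<Longrightarrow> Q v"
    and step: "\<And>T a b c. T \<in> patch_triangles \<T> W \<Longrightarrow> verts T = {a, b, c} \<Longrightarrow> a \<noteq> b \<Longrightarrow> a \<noteq> c \<Longrightarrow> b \<noteq> c \<Longrightarrow>
      Q a \<Longrightarrow> Q b \<Longrightarrow> Q c"
    and v: "v \<in> patch_vertices \<T> W"
  shows "Q v"
proof (rule ccontr)
  assume "\<not> Q v"
  let ?P = "patch_triangles \<T> W"
  define Z where "Z = {T\<in>?P. \<forall>v\<in>verts T. Q v}"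
  define Y where "Y = ?P - Z"
  have W: "closed W" "connected W" "lipschitz_boundary W" "W = \<Union>?P"
    using patch vertex_patch_triangles(1)[OF patch] by (auto simp: vertex_patch_def)
  have simp2: "2 simplex T" if "T \<in> ?P" for T using mesh_simplex[OF mesh] that by (auto simp: patch_triangles_def)
  have fin: "finite ?P" using mesh by (auto simp: mesh_of_def triangulation_def patch_triangles_def)
  have closedT: "closed T" if "T \<in> ?P" for T
    using verts_simplex(3,4)[OF simp2[OF that]] finite_imp_compact_convex_hull compact_imp_closed by metis
  have limT: "x islimpt T" if "T \<in> ?P" "x \<in> T" for T x
  proof -
    have "connected T" using verts_simplex(3)[OF simp2[OF that(1)]] convex_connected convex_convex_hull by metis
    moreover have "T \<noteq> {x}"
    proof
      assume "T = {x}"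
      then have "verts T \<subseteq> {x}" using verts_subset[of T] by simp
      then show False using verts_simplex(2)[OF simp2[OF that(1)]] card_mono[of "{x}" "verts T"] by simp
    qed
    ultimately show ?thesis using connected_imp_perfect that(2) by blast
  qed
  have finZY: "finite Z" "finite Y" using fin by (auto simp: Z_def Y_def)
  have neZ: "T0 \<in> Z" using T0 by (auto simp: Z_def)
  obtain T1 where T1: "T1 \<in> ?P" "v \<in> verts T1" using v patch_vertices_iff[OF mesh W(4)] by blast
  then have neY: "T1 \<in> Y" using \<open>\<not> Q v\<close> by (auto simp: Y_def Z_def)
  have nonempty: "T \<noteq> {}" if "T \<in> ?P" for T
  proof
    assume "T = {}"
    then have "verts T = {}" using verts_subset[of T] by simp
    then show False using verts_simplex(2)[OF simp2[OF that]] by simp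
  qed
  have "finite (T \<inter> T')" if T: "T \<in> Z" "T' \<in> Y" for T T'
  proof -
    have TT: "T \<in> ?P" "T' \<in> ?P" using T by (auto simp: Z_def Y_def)
    have one: "a = b" if ab: "a \<in> verts T \<inter> verts T'" "b \<in> verts T \<inter> verts T'" for a b
    proof (rule ccontr)
      assume "a \<noteq> b"
      then obtain c where c: "verts T' = {a, b, c}" "c \<noteq> a" "c \<noteq> b"
        using simplex_third_vertex[OF simp2[OF TT(2)], of a b] ab by blast
      have "Q a" "Q b" using ab T by (auto simp: Z_def)
      then have "Q c" using step[OF TT(2) c(1)] c \<open>a \<noteq> b\<close> by blast
      then have "T' \<in> Z" using \<open>Q a\<close> \<open>Q b\<close> c TT by (auto simp: Z_def)
      then show False using T by (simp add: Y_def)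
    qed
    have "verts T \<inter> verts T' = {} \<or> (\<exists>a. verts T \<inter> verts T' = {a})" using one by blast
    moreover have "T \<inter> T' = convex hull (verts T \<inter> verts T')"
      using mesh_inter[OF mesh] TT by (auto simp: patch_triangles_def)
    ultimately show ?thesis by (metis convex_hull_empty convex_hull_singleton finite.emptyI finite_insert)
  qed
  then have "finite (\<Union>T\<in>Z. \<Union>T'\<in>Y. T \<inter> T')" by (intro finite_UN_I finZY)
  then have fini: "finite (\<Union>Z \<inter> \<Union>Y)" by (rule finite_subset[rotated]) blast
  show False
  proof (rule lipschitz_no_finite_cut[OF W(1-3) _ _ _ _ _ fini])
    show "closed (\<Union>Z)" "closed (\<Union>Y)" using finZY closedT by (auto intro!: closed_Union simp: Z_def Y_def)
    have "Z \<union> Y = ?P" by (auto simp: Z_def Y_def)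
    then show "\<Union>Z \<union> \<Union>Y = W" using W(4) by (metis Union_Un_distrib)
    show "\<Union>Z \<noteq> {}" "\<Union>Y \<noteq> {}" using neZ neY nonempty by (auto simp: Z_def Y_def)
    fix x assume "x \<in> \<Union>Z \<inter> \<Union>Y"
    then obtain T T' where "T \<in> Z" "T' \<in> Y" "x \<in> T" "x \<in> T'" by blast
    then show "x islimpt \<Union>Z \<and> x islimpt \<Union>Y"
      using limT islimpt_subset by (metis (no_types, lifting) DiffD1 Sup_upper Y_def Z_def mem_Collect_eq)
  qed
qed

section \<open>Quadratic polynomials that vanish on a patch\<close>

lemma line_through:
  assumes "d \<noteq> 0"
  shows "is_line {x. cross2 d (x - z) = 0}"
proof -
  have "{x. cross2 d (x - z) = 0} = affine hull {z, z + d}"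
  proof
    show "affine hull {z, z + d} \<subseteq> {x. cross2 d (x - z) = 0}"
      by (auto simp: affine_hull_2_alt cross2_def algebra_simps)
    show "{x. cross2 d (x - z) = 0} \<subseteq> affine hull {z, z + d}"
    proof
      fix x assume x: "x \<in> {x. cross2 d (x - z) = 0}"
      have "(d \<bullet> d) *\<^sub>R (x - z) = (d \<bullet> (x - z)) *\<^sub>R d + cross2 d (x - z) *\<^sub>R rot d"
        unfolding vec2_eq_iff by (simp add: cross2_def inner2 algebra_simps)
      then have "(1 / (d \<bullet> d)) *\<^sub>R ((d \<bullet> d) *\<^sub>R (x - z)) = (1 / (d \<bullet> d)) *\<^sub>R ((d \<bullet> (x - z)) *\<^sub>R d)"
        using x by simp
      then have "x - z = ((d \<bullet> (x - z)) / (d \<bullet> d)) *\<^sub>R d" using assms by simp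
      then have "x = z + ((d \<bullet> (x - z)) / (d \<bullet> d)) *\<^sub>R (z + d - z)" by (simp add: algebra_simps)
      then show "x \<in> affine hull {z, z + d}" unfolding affine_hull_2_alt by blast
    qed
  qed
  moreover have "z \<noteq> z + d" using assms by simp
  ultimately show ?thesis by (simp add: is_line_def)
qed

lemma cross2_eq_0_rays:
  assumes "cross2 d v = 0" "d \<noteq> 0" "v \<noteq> 0"
  shows "\<exists>k>0. v = k *\<^sub>R d \<or> v = k *\<^sub>R (- d)"
proof -
  have "(d \<bullet> d) *\<^sub>R v = (d \<bullet> v) *\<^sub>R d + cross2 d v *\<^sub>R rot d"
    unfolding vec2_eq_iff by (simp add: cross2_def inner2 algebra_simps)
  then have "(1 / (d \<bullet> d)) *\<^sub>R ((d \<bullet> d) *\<^sub>R v) = (1 / (d \<bullet> d)) *\<^sub>R ((d \<bullet> v) *\<^sub>R d)"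
    using assms(1) by simp
  then have v: "v = ((d \<bullet> v) / (d \<bullet> d)) *\<^sub>R d" using assms(2) by simp
  define k where "k = (d \<bullet> v) / (d \<bullet> d)"
  have v: "v = k *\<^sub>R d" using v by (simp add: k_def)
  then have "k \<noteq> 0" using assms(3) by auto
  then consider "k > 0" | "- k > 0" by linarith
  then show ?thesis using v by cases (auto intro!: exI[of _ "\<bar>k\<bar>"])
qed

lemma num_neighbours_eq:
  assumes "mesh_of \<Omega> \<T>" "vertex_patch \<T> z W"
  shows "num_neighbours \<T> z W = card (spoke_ends \<T> z)" "spoke_ends \<T> z \<subseteq> patch_vertices \<T> W"
proof -
  note W = vertex_patch_triangles[OF assms(2)]
  show sub: "spoke_ends \<T> z \<subseteq> patch_vertices \<T> W"
    using W(2) patch_vertices_iff[OF assms(1) W(1)] by (auto simp: spoke_ends_def)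
  then have "{v \<in> patch_vertices \<T> W. directly_connected \<T> z v} = spoke_ends \<T> z"
    using mesh_edges_segment_iff[OF assms(1), of z] by (auto simp: directly_connected_def spoke_ends_def)
  then show "num_neighbours \<T> z W = card (spoke_ends \<T> z)" by (simp add: num_neighbours_def)
qed

text \<open>Two lines through \<open>z\<close> consist of four rays from \<open>z\<close>.\<close>

lemma spokes_on_two_lines:
  assumes mesh: "mesh_of \<Omega> \<T>" and "d \<noteq> 0" "e \<noteq> 0"
    and on: "\<And>v. v \<in> spoke_ends \<T> z \<Longrightarrow> cross2 d (v - z) = 0 \<or> cross2 e (v - z) = 0"
  shows "card (spoke_ends \<T> z) \<le> 4"
proof -
  define ray where "ray D = {v\<in>spoke_ends \<T> z. \<exists>k>0. v - z = k *\<^sub>R D}" for D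
  have ray: "finite (ray D) \<and> card (ray D) \<le> 1" for D
  proof -
    have "v = w" if vw: "v \<in> ray D" "w \<in> ray D" for v w
    proof -
      obtain k j where k: "k > 0" "v - z = k *\<^sub>R D" and j: "j > 0" "w - z = j *\<^sub>R D"
        using vw by (auto simp: ray_def)
      have "w - z = (j / k) *\<^sub>R (v - z)" "0 < j / k" using k j by auto
      moreover obtain T T' where "T \<in> \<T>" "z \<in> verts T" "v \<in> verts T" "z \<noteq> v"
        "T' \<in> \<T>" "z \<in> verts T'" "w \<in> verts T'" "z \<noteq> w" using vw by (auto simp: ray_def spoke_ends_def)
      ultimately show ?thesis using mesh_spoke_unique[OF mesh] by metis
    qed
    then have "ray D = {} \<or> (\<exists>v. ray D = {v})" by blast
    then show ?thesis by auto
  qed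
  have "spoke_ends \<T> z \<subseteq> (ray d \<union> ray (- d)) \<union> (ray e \<union> ray (- e))"
  proof
    fix v assume v: "v \<in> spoke_ends \<T> z"
    then have "v - z \<noteq> 0" by (auto simp: spoke_ends_def)
    then obtain k where "k > 0" "(v - z = k *\<^sub>R d \<or> v - z = k *\<^sub>R (- d)) \<or> (v - z = k *\<^sub>R e \<or> v - z = k *\<^sub>R (- e))"
      using on[OF v] cross2_eq_0_rays assms(2,3) by metis
    then show "v \<in> (ray d \<union> ray (- d)) \<union> (ray e \<union> ray (- e))" using v unfolding ray_def by blast
  qed
  then have "card (spoke_ends \<T> z) \<le> card ((ray d \<union> ray (- d)) \<union> (ray e \<union> ray (- e)))"
    using ray by (intro card_mono) auto
  also have "\<dots> \<le> (card (ray d) + card (ray (- d))) + (card (ray e) + card (ray (- e)))"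
    by (meson add_mono card_Un_le order_trans)
  also have "\<dots> \<le> 4" using ray[of d] ray[of "- d"] ray[of e] ray[of "- e"] by simp
  finally show ?thesis .
qed

definition quadratic :: "real \<Rightarrow> real^2 \<Rightarrow> real \<Rightarrow> real \<Rightarrow> real \<Rightarrow> real^2 \<Rightarrow> real" where
  "quadratic k l p r s x = k + l \<bullet> x + bil p r s x x"

text \<open>The polynomial vanishes at \<open>z\<close>, and by the fan argument so does its linear part \<open>l'\<close>
  there.  If the quadratic form that is left were not zero, all vertices would lie on two lines through
  \<open>z\<close>, and the number of neighbours would be four.\<close>

lemma conic_through_patch_vertices:
  assumes mesh: "mesh_of \<Omega> \<T>" and "open \<Omega>" "z \<in> \<Omega>" and patch: "vertex_patch \<T> z W"
    and ang: "adjacent_angle_condition \<T> W" and z: "z \<in> patch_vertices \<T> W"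
    and n: "num_neighbours \<T> z W \<ge> 4"
    and two: "num_neighbours \<T> z W = 4 \<Longrightarrow> \<not> on_two_lines (patch_vertices \<T> W)"
    and q: "\<And>v. v \<in> patch_vertices \<T> W \<Longrightarrow> quadratic k l p r s v = 0"
  shows "k = 0 \<and> l = 0 \<and> p = 0 \<and> r = 0 \<and> s = 0"
proof -
  note N = num_neighbours_eq[OF mesh patch]
  define l' where "l' = l + vector [2 * (p * z$1 + r * z$2), 2 * (r * z$1 + s * z$2)]"
  have shift: "bil p r s (v - z) (v - z) + l' \<bullet> (v - z) = 0" if "v \<in> patch_vertices \<T> W" for v
  proof -
    have "bil p r s (v - z) (v - z) + l' \<bullet> (v - z) = quadratic k l p r s v - quadratic k l p r s z"
      by (simp add: quadratic_def bil_def l'_def inner2 algebra_simps)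
    then show ?thesis using q[OF z] q[OF that] by simp
  qed
  have ne: "spoke_ends \<T> z \<noteq> {}" using N n by auto
  have l': "l' = 0"
    using conic_through_fan_has_no_linear_part[OF convex_fan_of_patch[OF mesh assms(2,3) patch ang ne]] shift N(2)
    by blast
  have "p = 0 \<and> r = 0 \<and> s = 0"
  proof (rule ccontr)
    assume "\<not> (p = 0 \<and> r = 0 \<and> s = 0)"
    then obtain d e where de: "d \<noteq> 0" "e \<noteq> 0" "\<And>v. bil p r s v v = 0 \<Longrightarrow> cross2 d v = 0 \<or> cross2 e v = 0"
      using bil_zeros_on_two_lines by metis
    have on: "cross2 d (v - z) = 0 \<or> cross2 e (v - z) = 0" if "v \<in> patch_vertices \<T> W" for v
      using de(3) shift[OF that] l' by simp
    then have "patch_vertices \<T> W \<subseteq> {x. cross2 d (x - z) = 0} \<union> {x. cross2 e (x - z) = 0}" by blast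
    then have "on_two_lines (patch_vertices \<T> W)" unfolding on_two_lines_def
      using line_through de(1,2) by blast
    moreover have "num_neighbours \<T> z W = 4"
      using spokes_on_two_lines[OF mesh de(1,2)] on N n by (metis le_antisym subsetD)
    ultimately show False using two by blast
  qed
  moreover then have "l = 0" using l' by (simp add: l'_def vec2_eq_iff)
  ultimately show ?thesis using q[OF z] by (simp add: quadratic_def bil_def)
qed

section \<open>Quadratic displacements with given strain\<close>

definition affval :: "real^3 \<Rightarrow> real^2 \<Rightarrow> real" where
  "affval c x = c$1 + c$2 * x$1 + c$3 * x$2"

text \<open>The rows of \<open>c\<close> are the coefficients of the entries \<open>(1,1)\<close>, \<open>(1,2)\<close> and \<open>(2,2)\<close>.\<close>

definition affmat :: "real^3^3 \<Rightarrow> real^2 \<Rightarrow> real^2^2" where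
  "affmat c x = vector [vector [affval (c$1) x, affval (c$2) x], vector [affval (c$2) x, affval (c$3) x]]"

text \<open>A quadratic vector field whose strain is the field \<open>affmat c\<close> rotated by a right angle, that is, the
  field with diagonal entries \<open>affval (c $ 3)\<close> and \<open>affval (c $ 1)\<close> and off-diagonal entry
  \<open>- affval (c $ 2)\<close>.  The parameters \<open>t\<close> and \<open>w\<close> are the translation and the rotation of the rigid
  motion in it.\<close>

definition displacement :: "real^3^3 \<Rightarrow> real^2 \<Rightarrow> real \<Rightarrow> real^2 \<Rightarrow> real^2" where
  "displacement c t w x = vector
     [quadratic (t$1) (vector [c$3$1, - c$2$1 - w]) (c$3$2 / 2) (c$3$3 / 2) (- c$2$3 - c$1$2 / 2) x,
      quadratic (t$2) (vector [- c$2$1 + w, c$1$1]) (- c$2$2 - c$3$3 / 2) (c$1$2 / 2) (c$1$3 / 2) x]"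

lemma quad_form_affmat:
  "v \<bullet> (affmat c x *v v) = affval (c$1) x * (v$1)^2 + 2 * affval (c$2) x * (v$1 * v$2) + affval (c$3) x * (v$2)^2"
  by (simp add: affmat_def inner2 matrix_vector_mult_def sum_2 power2_eq_square algebra_simps)

text \<open>The derivative of \<open>u \<bullet> (b - a)\<close> along the edge is the strain in direction of the edge.  It is affine,
  so its integral over the edge is given by the midpoint value.\<close>

lemma displacement_stretch:
  "(displacement c t w b - displacement c t w a) \<bullet> (b - a) = rot (b - a) \<bullet> (affmat c (midpoint a b) *v rot (b - a))"
  unfolding quad_form_affmat
  by (simp add: displacement_def quadratic_def bil_def affval_def inner2 midpoint_def power2_eq_square field_simps)

lemma displacement_rigid_motion:
  "displacement c t w x = displacement c 0 0 x + t + w *\<^sub>R rot x"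
  unfolding vec2_eq_iff by (simp add: displacement_def quadratic_def inner2 algebra_simps)

text \<open>A displacement that vanishes identically has no strain.\<close>

lemma displacement_eq_0_imp:
  assumes "\<And>k l p r s. (\<And>v. v \<in> V \<Longrightarrow> quadratic k l p r s v = 0) \<Longrightarrow> k = 0 \<and> l = 0 \<and> p = 0 \<and> r = 0 \<and> s = 0"
    and 0: "\<And>v. v \<in> V \<Longrightarrow> displacement c t w v = 0"
  shows "c = 0"
proof -
  have q: "quadratic (t$1) (vector [c$3$1, - c$2$1 - w]) (c$3$2 / 2) (c$3$3 / 2) (- c$2$3 - c$1$2 / 2) v = 0"
    "quadratic (t$2) (vector [- c$2$1 + w, c$1$1]) (- c$2$2 - c$3$3 / 2) (c$1$2 / 2) (c$1$3 / 2) v = 0" if "v \<in> V" for v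
    using 0[OF that] by (simp_all add: displacement_def vec2_eq_iff)
  have "(vector [c$3$1, - c$2$1 - w] :: real^2) = 0" "c$3$2 / 2 = 0" "c$3$3 / 2 = 0" "- c$2$3 - c$1$2 / 2 = 0"
    using assms(1)[OF q(1)] by blast+
  moreover have "(vector [- c$2$1 + w, c$1$1] :: real^2) = 0" "- c$2$2 - c$3$3 / 2 = 0" "c$1$2 / 2 = 0" "c$1$3 / 2 = 0"
    using assms(1)[OF q(2)] by blast+
  ultimately show ?thesis by (simp add: vec_eq_iff[of c] vec_eq_iff[of "c $ _"] forall_3 vec2_eq_iff)
qed

text \<open>The displacement difference of two vertices is orthogonal to their edge, like that of a rotation.  So a
  rigid motion can cancel both displacements.\<close>

lemma pin_edge:
  assumes "a \<noteq> b" and "(displacement c 0 0 b - displacement c 0 0 a) \<bullet> (b - a) = 0"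
  obtains t w where "displacement c t w a = 0" "displacement c t w b = 0"
proof -
  define u where "u = displacement c 0 0 b - displacement c 0 0 a"
  have "((b - a) \<bullet> (b - a)) *\<^sub>R u = (rot (b - a) \<bullet> u) *\<^sub>R rot (b - a) + (u \<bullet> (b - a)) *\<^sub>R (b - a)"
    unfolding vec2_eq_iff by (simp add: inner2 algebra_simps)
  then have "(1 / ((b - a) \<bullet> (b - a))) *\<^sub>R (((b - a) \<bullet> (b - a)) *\<^sub>R u)
      = (1 / ((b - a) \<bullet> (b - a))) *\<^sub>R ((rot (b - a) \<bullet> u) *\<^sub>R rot (b - a))" using assms(2) by (simp add: u_def)
  then have "u = ((rot (b - a) \<bullet> u) / ((b - a) \<bullet> (b - a))) *\<^sub>R rot (b - a)" using assms(1) by simp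
  then obtain k where k: "u = k *\<^sub>R rot (b - a)" by blast
  define t where "t = - displacement c 0 0 a + k *\<^sub>R rot a"
  have "displacement c t (- k) a = 0" by (subst displacement_rigid_motion) (simp add: t_def)
  moreover have "displacement c t (- k) b = 0"
  proof -
    have rd: "rot (b - a) = rot b - rot a" by (simp add: vec2_eq_iff)
    have "displacement c t (- k) b = u - k *\<^sub>R rot (b - a)"
      unfolding rd by (subst displacement_rigid_motion) (simp add: t_def u_def algebra_simps)
    then show ?thesis using k by simp
  qed
  ultimately show ?thesis using that by blast
qed

section \<open>Normal-normal components on edges\<close>

lemma edge_normal_spec:
  assumes "a \<noteq> b"
  shows "edge_normal (closed_segment a b) = (1 / norm (b - a)) *\<^sub>R rot (b - a)
    \<or> edge_normal (closed_segment a b) = - ((1 / norm (b - a)) *\<^sub>R rot (b - a))"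
proof -
  define d where "d = b - a"
  define n where "n = edge_normal (closed_segment a b)"
  have d0: "d \<noteq> 0" using assms by (simp add: d_def)
  have nrot: "norm (rot d) = norm d" by (simp add: norm_eq_sqrt_inner inner2 add.commute)
  have orth: "(\<forall>x\<in>closed_segment a b. \<forall>y\<in>closed_segment a b. m \<bullet> (x - y) = 0) \<longleftrightarrow> m \<bullet> d = 0" for m
  proof
    assume "m \<bullet> d = 0"
    then have md: "m \<bullet> b = m \<bullet> a" by (simp add: d_def inner_diff_right)
    have "m \<bullet> x = m \<bullet> a" if x: "x \<in> closed_segment a b" for x
    proof -
      obtain u where "x = (1 - u) *\<^sub>R a + u *\<^sub>R b" using x by (auto simp: in_segment)
      then have "m \<bullet> x = (1 - u) * (m \<bullet> a) + u * (m \<bullet> b)" by (simp add: inner_add_right)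
      then show ?thesis using md by (simp add: algebra_simps)
    qed
    then show "\<forall>x\<in>closed_segment a b. \<forall>y\<in>closed_segment a b. m \<bullet> (x - y) = 0"
      by (metis inner_diff_right right_minus_eq)
  qed (simp add: d_def)
  have "norm ((1 / norm d) *\<^sub>R rot d) = 1 \<and> ((1 / norm d) *\<^sub>R rot d) \<bullet> d = 0"
    using d0 nrot by (simp add: inner2)
  then have n: "norm n = 1" "n \<bullet> d = 0"
    using someI_ex[of "\<lambda>n. norm n = 1 \<and> n \<bullet> d = 0"] unfolding n_def edge_normal_def orth by blast+
  define k where "k = (rot d \<bullet> n) / (norm d)"
  have "(norm d)^2 *\<^sub>R n = (rot d \<bullet> n) *\<^sub>R rot d + (n \<bullet> d) *\<^sub>R d"
    unfolding vec2_eq_iff power2_norm_eq_inner by (simp add: inner2 algebra_simps)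
  then have "(1 / (norm d)^2) *\<^sub>R ((norm d)^2 *\<^sub>R n) = (1 / (norm d)^2) *\<^sub>R ((rot d \<bullet> n) *\<^sub>R rot d)" using n(2) by simp
  then have nk: "n = k *\<^sub>R ((1 / norm d) *\<^sub>R rot d)" using d0 by (simp add: k_def power2_eq_square)
  then have "\<bar>k\<bar> = 1" using n(1) d0 nrot by (metis \<open>norm ((1 / norm d) *\<^sub>R rot d) = 1 \<and> _\<close> mult.right_neutral norm_scaleR)
  then have "k = 1 \<or> k = - 1" by linarith
  then show ?thesis using nk unfolding n_def[symmetric] d_def[symmetric] by auto
qed

lemma nn_segment:
  assumes "a \<noteq> b"
  shows "nn (closed_segment a b) A = rot (b - a) \<bullet> (A *v rot (b - a)) / (norm (b - a))^2"
proof -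
  obtain k where k: "edge_normal (closed_segment a b) = k *\<^sub>R rot (b - a)" "k^2 = 1 / (norm (b - a))^2"
    using edge_normal_spec[OF assms]
  proof
    assume "edge_normal (closed_segment a b) = - ((1 / norm (b - a)) *\<^sub>R rot (b - a))"
    then show ?thesis using that[of "- (1 / norm (b - a))"] by (simp add: power_divide)
  qed (use that[of "1 / norm (b - a)"] in \<open>simp add: power_divide\<close>)
  then show ?thesis by (simp add: nn_def matrix_vector_mult_scaleR flip: mult.assoc power2_eq_square)
qed

lemma edge_midpoint_segment [simp]: "edge_midpoint (closed_segment a b) = midpoint a b"
  unfolding edge_midpoint_def
  by (rule the_equality) (auto simp: doubleton_eq_iff midpoint_sym)

section \<open>Least squares\<close>

text \<open>The operator of the normal equations is injective, because \<open>c \<bullet> M c\<close> is the sum of the squares of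
  the \<open>L e c\<close>, and hence surjective.  At a solution \<open>c0\<close> the residual is orthogonal to the range, which
  is Pythagoras' theorem.\<close>

lemma least_squares_split:
  fixes L :: "'i \<Rightarrow> 'a::euclidean_space \<Rightarrow> real"
  assumes lin: "\<And>e. e \<in> E \<Longrightarrow> linear (L e)"
    and inj: "\<And>c. (\<And>e. e \<in> E \<Longrightarrow> L e c = 0) \<Longrightarrow> c = 0" and fin: "finite E"
  obtains c0 where "\<And>c. (\<Sum>e\<in>E. (L e c - d e)\<^sup>2) = (\<Sum>e\<in>E. (L e c0 - d e)\<^sup>2) + (\<Sum>e\<in>E. (L e (c - c0))\<^sup>2)"
proof -
  define w where "w e = adjoint (L e) 1" for e
  have w: "L e c = c \<bullet> w e" if "e \<in> E" for e c
    using adjoint_works[OF lin[OF that], of c 1] by (simp add: w_def)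
  define M where "M c = (\<Sum>e\<in>E. (c \<bullet> w e) *\<^sub>R w e)" for c
  have linM: "linear M" unfolding M_def
    by (rule linearI) (simp_all add: inner_add_left scaleR_add_left sum.distrib scaleR_sum_right)
  have "inj M" unfolding linear_injective_0[OF linM]
  proof safe
    fix c assume "M c = 0"
    then have "0 = c \<bullet> M c" by simp
    also have "\<dots> = (\<Sum>e\<in>E. (c \<bullet> w e)\<^sup>2)" by (simp add: M_def inner_sum_right power2_eq_square)
    finally have "\<forall>e\<in>E. (c \<bullet> w e)\<^sup>2 = 0" using fin by (simp add: sum_nonneg_eq_0_iff)
    then show "c = 0" using inj w by auto
  qed
  then have "surj M" using linear_injective_imp_surjective[OF linM] by blast
  then obtain c0 where c0: "M c0 = (\<Sum>e\<in>E. d e *\<^sub>R w e)" by (metis surjD)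
  show ?thesis
  proof
    fix c
    have orth: "(\<Sum>e\<in>E. (L e c0 - d e) * L e (c - c0)) = 0"
    proof -
      have "(\<Sum>e\<in>E. (L e c0 - d e) * L e (c - c0)) = (c - c0) \<bullet> (M c0 - (\<Sum>e\<in>E. d e *\<^sub>R w e))"
        by (simp add: M_def w inner_diff_right inner_sum_right sum_subtractf[symmetric] algebra_simps)
      then show ?thesis using c0 by simp
    qed
    have "(\<Sum>e\<in>E. (L e c - d e)\<^sup>2)
        = (\<Sum>e\<in>E. (L e c0 - d e)\<^sup>2 + (L e (c - c0))\<^sup>2 + 2 * ((L e c0 - d e) * L e (c - c0)))"
      by (rule sum.cong) (simp_all add: w inner_diff_left power2_eq_square algebra_simps)
    then show "(\<Sum>e\<in>E. (L e c - d e)\<^sup>2) = (\<Sum>e\<in>E. (L e c0 - d e)\<^sup>2) + (\<Sum>e\<in>E. (L e (c - c0))\<^sup>2)"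
      using orth by (simp add: sum.distrib flip: sum_distrib_left)
  qed
qed

section \<open>Unisolvence of the edge values\<close>

lemma linear_nn_affmat: "linear (\<lambda>c. nn e (affmat c x))"
proof (rule linearI)
  fix c d :: "real^3^3" and k :: real
  show "nn e (affmat (c + d) x) = nn e (affmat c x) + nn e (affmat d x)"
    unfolding nn_def quad_form_affmat by (simp add: affval_def algebra_simps)
  show "nn e (affmat (k *\<^sub>R c) x) = k *\<^sub>R nn e (affmat c x)"
    unfolding nn_def quad_form_affmat by (simp add: affval_def algebra_simps)
qed

lemma sym_fields_P1: "sym_fields (P1 W) = range (\<lambda>c x. if x \<in> W then affmat c x else 0)"
proof
  show "range (\<lambda>c x. if x \<in> W then affmat c x else 0) \<subseteq> sym_fields (P1 W)"
  proof safe
    fix c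
    let ?\<tau> = "\<lambda>x. if x \<in> W then affmat c x else 0"
    have "transpose (?\<tau> x) = ?\<tau> x" for x
      by (simp add: affmat_def transpose_def vec_eq_iff forall_2)
    moreover have aff: "(\<lambda>x. if x \<in> W then affval k x else 0) \<in> P1 W" for k
      unfolding P1_def
      by (auto intro!: exI[of _ "k$1"] exI[of _ "vector [k$2, k$3]"] simp: affval_def inner2)
    have "\<forall>i j. (\<lambda>x. ?\<tau> x $ i $ j) \<in> P1 W"
      using aff[of "c$1"] aff[of "c$2"] aff[of "c$3"]
      by (simp add: forall_2 affmat_def if_distrib[of "\<lambda>m. m $ _ $ _"] cong: if_cong)
    ultimately show "?\<tau> \<in> sym_fields (P1 W)" by (simp add: sym_fields_def)
  qed
  show "sym_fields (P1 W) \<subseteq> range (\<lambda>c x. if x \<in> W then affmat c x else 0)"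
  proof
    fix \<tau> assume \<tau>: "\<tau> \<in> sym_fields (P1 W)"
    then have "\<exists>k. \<forall>x. \<tau> x $ i $ j = (if x \<in> W then affval k x else 0)" for i j
    proof -
      obtain a b where "\<forall>x. \<tau> x $ i $ j = (if x \<in> W then a + b \<bullet> x else 0)"
        using \<tau> unfolding sym_fields_def P1_def by blast
      then show ?thesis by (intro exI[of _ "vector [a, b$1, b$2]"]) (simp add: affval_def inner2)
    qed
    then obtain k where k: "\<And>i j x. \<tau> x $ i $ j = (if x \<in> W then affval (k i j) x else 0)" by metis
    have "\<tau> x $ 2 $ 1 = \<tau> x $ 1 $ 2" for x
    proof -
      have "transpose (\<tau> x) $ 1 $ 2 = \<tau> x $ 1 $ 2" using \<tau> by (simp add: sym_fields_def)
      then show ?thesis by (simp add: transpose_def)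
    qed
    then have "\<tau> = (\<lambda>x. if x \<in> W then affmat (vector [k 1 1, k 1 2, k 2 2]) x else 0)"
      using k by (auto simp: fun_eq_iff vec_eq_iff forall_2 affmat_def)
    then show "\<tau> \<in> range (\<lambda>c x. if x \<in> W then affmat c x else 0)" by blast
  qed
qed

lemma patch_edge_form:
  assumes "mesh_of \<Omega> \<T>" "e \<in> patch_edges \<T> W"
  obtains a b where "a \<noteq> b" "e = closed_segment a b"
proof -
  obtain T where "T \<in> \<T>" "e edge_of T" using assms by (auto simp: patch_edges_def mesh_edges_def)
  then show ?thesis using simplex_edge_iff[OF mesh_simplex[OF assms(1)]] that by blast
qed

lemma finite_patch_edges:
  assumes mesh: "mesh_of \<Omega> \<T>"
  shows "finite (patch_edges \<T> W)"
proof -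
  have "finite (\<Union>T\<in>\<T>. (\<lambda>(a, b). closed_segment a b) ` (verts T \<times> verts T))"
    using mesh verts_simplex(4) mesh_simplex[OF mesh] by (auto simp: mesh_of_def triangulation_def)
  then show ?thesis
    by (rule finite_subset[rotated])
      (use simplex_edge_iff[OF mesh_simplex[OF mesh]] in \<open>fastforce simp: patch_edges_def mesh_edges_def\<close>)
qed

text \<open>The displacement of the field is pinned at an edge of one triangle at \<open>z\<close>.  A point that keeps its
  distance to two fixed points, to first order, is itself fixed if the three are not collinear.  So the
  displacement vanishes at every vertex of the patch, and its two components are zero as
  polynomials.\<close>

lemma nn_vanishing_imp_zero:
  assumes mesh: "mesh_of \<Omega> \<T>" and "open \<Omega>" "z \<in> \<Omega>" and patch: "vertex_patch \<T> z W"
    and ang: "adjacent_angle_condition \<T> W" and z: "z \<in> mesh_vertices \<T>"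
    and n: "num_neighbours \<T> z W \<ge> 4"
    and two: "num_neighbours \<T> z W = 4 \<Longrightarrow> \<not> on_two_lines (patch_vertices \<T> W)"
    and nn0: "\<And>e. e \<in> patch_edges \<T> W \<Longrightarrow> nn e (affmat c (edge_midpoint e)) = 0"
  shows "c = 0"
proof -
  obtain T0 where T0: "T0 \<in> \<T>" "z \<in> verts T0" using z by (auto simp: mesh_vertices_def verts_def)
  have P0: "T0 \<in> patch_triangles \<T> W" using vertex_patch_triangles(2)[OF patch T0] .
  have simp2: "2 simplex T" if "T \<in> patch_triangles \<T> W" for T
    using mesh_simplex[OF mesh] that by (auto simp: patch_triangles_def)
  have flex: "(displacement c t w b - displacement c t w a) \<bullet> (b - a) = 0"
    if T: "T \<in> patch_triangles \<T> W" "a \<in> verts T" "b \<in> verts T" "a \<noteq> b" for T a b t w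
    using nn0[OF patch_edges_segment[OF mesh T]] T(4) by (simp add: nn_segment displacement_stretch)
  have third: "displacement c t w k = 0"
    if T: "T \<in> patch_triangles \<T> W" "verts T = {a, b, k}" "a \<noteq> b" "a \<noteq> k" "b \<noteq> k"
      and ab: "displacement c t w a = 0" "displacement c t w b = 0" for T a b k t w
  proof (rule orthogonal_to_independent)
    show "displacement c t w k \<bullet> (a - k) = 0" "displacement c t w k \<bullet> (b - k) = 0"
      using flex[OF T(1), of k a t w] flex[OF T(1), of k b t w] T ab by auto
    show "cross2 (a - k) (b - k) \<noteq> 0"
      using simplex_vertices_cross2[OF simp2[OF T(1)], of k a b] T by auto
  qed
  have "\<exists>b\<in>verts T0. b \<noteq> z"
  proof (rule ccontr)
    assume "\<not> ?thesis"
    then have "verts T0 \<subseteq> {z}" by blast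
    then show False using verts_simplex(2)[OF simp2[OF P0]] card_mono[of "{z}" "verts T0"] by simp
  qed
  then obtain b where b: "b \<in> verts T0" "z \<noteq> b" by blast
  obtain k where k: "verts T0 = {z, b, k}" "k \<noteq> z" "k \<noteq> b"
    using simplex_third_vertex[OF simp2[OF P0] T0(2) b] by metis
  obtain t w where tw: "displacement c t w z = 0" "displacement c t w b = 0"
    using pin_edge[OF b(2) flex[OF P0 T0(2) b]] by blast
  have base: "displacement c t w v = 0" if "v \<in> verts T0" for v
    using that k tw third[OF P0 k(1) b(2) _ _ tw] by auto
  have all: "displacement c t w v = 0" if "v \<in> patch_vertices \<T> W" for v
    using patch_vertex_propagation[OF mesh patch P0, where Q = "\<lambda>v. displacement c t w v = 0"] base third that
    by blast
  have "z \<in> patch_vertices \<T> W"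
    using patch_vertices_iff[OF mesh vertex_patch_triangles(1)[OF patch]] P0 T0(2) by blast
  then show ?thesis
    using displacement_eq_0_imp[OF conic_through_patch_vertices[OF mesh assms(2,3) patch ang _ n two] all] by blast
qed

theorem lemma4p2:
  fixes \<Omega> \<Gamma>c \<Gamma>s \<Gamma>f \<Omega>z :: "(real^2) set"
    and \<T> :: "(real^2) set set"
    and \<kappa> :: real
    and z :: "real^2"
    and \<tau>h :: "(real^2) set \<Rightarrow> real^2^2"
  assumes "polygonal_domain \<Omega>"
    and "boundary_partition \<Omega> \<Gamma>c \<Gamma>s \<Gamma>f"
    and "mesh_of \<Omega> \<T>"
    and "shape_regular \<kappa> \<T>"
    and "z \<in> mesh_vertices \<T>" and "z \<in> \<Omega>"
    and "vertex_patch \<T> z \<Omega>z"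
    and "num_neighbours \<T> z \<Omega>z \<ge> 4"
    and "adjacent_angle_condition \<T> \<Omega>z"
    and "num_neighbours \<T> z \<Omega>z = 4 \<Longrightarrow> \<not> on_two_lines (patch_vertices \<T> \<Omega>z)"
    and "\<tau>h \<in> Sigma1 \<Omega> (\<Gamma>s \<union> \<Gamma>f) \<T>"
  shows "\<exists>!\<tau>. is_arg_min (recovery_functional \<T> \<Omega>z \<tau>h) (\<lambda>\<sigma>. \<sigma> \<in> sym_fields (P1 \<Omega>z)) \<tau>"
proof -
  let ?E = "patch_edges \<T> \<Omega>z"
  define field where "field c x = (if x \<in> \<Omega>z then affmat c x else 0)" for c x
  define L where "L e c = nn e (affmat c (edge_midpoint e))" for e c
  define d where "d = edge_nn_value \<T> \<tau>h"
  have "open \<Omega>" using assms(1) by (simp add: polygonal_domain_def)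
  have fields: "sym_fields (P1 \<Omega>z) = range field" unfolding sym_fields_P1 field_def ..
  have mid: "edge_midpoint e \<in> \<Omega>z" if e: "e \<in> ?E" for e
  proof -
    obtain a b where "a \<noteq> b" "e = closed_segment a b" using patch_edge_form[OF assms(3) e] .
    then have "edge_midpoint e \<in> e" by simp
    then show ?thesis using e by (auto simp: patch_edges_def)
  qed
  have J: "recovery_functional \<T> \<Omega>z \<tau>h (field c) = (\<Sum>e\<in>?E. (L e c - d e)\<^sup>2)" for c
    unfolding recovery_functional_def by (rule sum.cong) (use mid in \<open>auto simp: field_def L_def d_def\<close>)
  have inj: "c = 0" if "\<And>e. e \<in> ?E \<Longrightarrow> L e c = 0" for c
    using nn_vanishing_imp_zero[OF assms(3) \<open>open \<Omega>\<close> assms(6,7,9,5,8,10)] that by (auto simp: L_def)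
  obtain c0 where c0: "\<And>c. (\<Sum>e\<in>?E. (L e c - d e)\<^sup>2)
      = (\<Sum>e\<in>?E. (L e c0 - d e)\<^sup>2) + (\<Sum>e\<in>?E. (L e (c - c0))\<^sup>2)"
    using least_squares_split[of ?E L d] linear_nn_affmat inj finite_patch_edges[OF assms(3)]
    unfolding L_def by blast
  show ?thesis
  proof
    show "is_arg_min (recovery_functional \<T> \<Omega>z \<tau>h) (\<lambda>\<sigma>. \<sigma> \<in> sym_fields (P1 \<Omega>z)) (field c0)"
      unfolding is_arg_min_linorder fields
    proof (intro conjI allI impI)
      fix \<sigma> assume "\<sigma> \<in> range field"
      then obtain c where "\<sigma> = field c" by blast
      moreover have "(\<Sum>e\<in>?E. (L e (c - c0))\<^sup>2) \<ge> 0" by (simp add: sum_nonneg)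
      ultimately show "recovery_functional \<T> \<Omega>z \<tau>h (field c0) \<le> recovery_functional \<T> \<Omega>z \<tau>h \<sigma>"
        unfolding J using c0[of c] J by simp
    qed simp
    fix \<tau> assume \<tau>: "is_arg_min (recovery_functional \<T> \<Omega>z \<tau>h) (\<lambda>\<sigma>. \<sigma> \<in> sym_fields (P1 \<Omega>z)) \<tau>"
    then obtain c where c: "\<tau> = field c" unfolding is_arg_min_linorder fields by blast
    have "recovery_functional \<T> \<Omega>z \<tau>h \<tau> \<le> recovery_functional \<T> \<Omega>z \<tau>h (field c0)"
      using \<tau> unfolding is_arg_min_linorder fields by blast
    then have "(\<Sum>e\<in>?E. (L e (c - c0))\<^sup>2) \<le> 0" unfolding c J using c0[of c] by simp
    then have "(\<Sum>e\<in>?E. (L e (c - c0))\<^sup>2) = 0" by (simp add: order.antisym sum_nonneg)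
    then have "L e (c - c0) = 0" if "e \<in> ?E" for e
      using that finite_patch_edges[OF assms(3)] by (simp add: sum_nonneg_eq_0_iff)
    then have "c - c0 = 0" by (rule inj)
    then show "\<tau> = field c0" using c by simp
  qed
qed

end
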